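(* Let $V$ be a real vector space of finite dimension $m\ge3$. Let $\mathcal{A}\in\mathfrak{F}(V)$ be Ricci flat. Then there exists the germ at the origin of a real analytic torsion free Ricci flat connection $\nabla$ on $T(V)$ with $\mathcal{R}_0^\nabla=\mathcal{A}$; that is, there exist an open neighborhood $U$ of $0$ in $V$ and a real analytic torsion free connection $\nabla$ on the tangent bundle of $U$ whose Ricci tensor vanishes identically on $U$ and whose curvature operator at $0$ equals $\mathcal{A}$.
   Context: Let $V$ be a real vector space of finite dimension $m$. An algebraic curvature operator on $V$ is an element $\mathcal{A}\in\otimes^2V^*\otimes\operatorname{End}(V)$ such that for all $x,y,z\in V$: $\mathcal{A}(x,y)z=-\mathcal{A}(y,x)z$ and $\mathcal{A}(x,y)z+\mathcal{A}(y,z)x+\mathcal{A}(z,x)y=0$. The space of these is denoted $\mathfrak{A}(V)$. The Ricci tensor of $\mathcal{A}$ is $\rho(x,y):=\operatorname{Tr}\{z\mapsto\mathcal{A}(z,x)y\}$. $\mathcal{A}$ is called an equiaffine (or Ricci symmetric) curvature operator if $\rho(x,y)=\rho(y,x)$ for all $x,y\in V$; $\mathfrak{F}(V)\subset\mathfrak{A}(V)$ denotes the set of all such operators. $\mathcal{A}\in\mathfrak{A}(V)$ is called Ricci flat if $\rho=0$ (such an operator is automatically in $\mathfrak{F}(V)$). For a torsion free connection $\nabla$ on the tangent bundle of a smooth manifold $M$, the curvature operator is $\mathcal{R}^\nabla(X,Y)Z=\nabla_X\nabla_YZ-\nabla_Y\nabla_XZ-\nabla_{[X,Y]}Z$, and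 $\mathcal{R}^\nabla_P\in\mathfrak{A}(T_PM)$ denotes its value at $P\in M$. The connection $\nabla$ is Ricci flat if $\mathcal{R}^\nabla_P$ is Ricci flat for all $P\in M$. A connection on an open subset of $V$ is real analytic if its Christoffel symbols with respect to linear coordinates on $V$ are real analytic functions. The tangent space $T_0V$ is canonically identified with $V$. *)

theory Defs
  imports "HOL-Analysis.Analysis"
begin

section \<open>Algebraic curvature operators\<close>

definition endo_trace :: "('a::euclidean_space \<Rightarrow> 'a) \<Rightarrow> real" where
  "endo_trace f = (\<Sum>b\<in>Basis. f b \<bullet> b)"

definition algebraic_curvature_operator ::
    "('a::euclidean_space \<Rightarrow> 'a \<Rightarrow> 'a \<Rightarrow> 'a) \<Rightarrow> bool" where
  "algebraic_curvature_operator A \<longleftrightarrow>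
     (\<forall>y z. linear (\<lambda>x. A x y z)) \<and>
     (\<forall>x z. linear (\<lambda>y. A x y z)) \<and>
     (\<forall>x y. linear (\<lambda>z. A x y z)) \<and>
     (\<forall>x y z. A x y z = - A y x z) \<and>
     (\<forall>x y z. A x y z + A y z x + A z x y = 0)"

definition ricci_tensor :: "('a::euclidean_space \<Rightarrow> 'a \<Rightarrow> 'a \<Rightarrow> 'a) \<Rightarrow> 'a \<Rightarrow> 'a \<Rightarrow> real" where
  "ricci_tensor A x y = endo_trace (\<lambda>z. A z x y)"

definition equiaffine_curvature_operators ::
    "('a::euclidean_space \<Rightarrow> 'a \<Rightarrow> 'a \<Rightarrow> 'a) set" where
  "equiaffine_curvature_operators =
     {A. algebraic_curvature_operator A \<and> (\<forall>x y. ricci_tensor A x y = ricci_tensor A y x)}"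

definition ricci_flat_operator :: "('a::euclidean_space \<Rightarrow> 'a \<Rightarrow> 'a \<Rightarrow> 'a) \<Rightarrow> bool" where
  "ricci_flat_operator A \<longleftrightarrow> (\<forall>x y. ricci_tensor A x y = 0)"

section \<open>Smooth and real analytic functions\<close>

text \<open>The following notions are only meant for open sets \<open>U\<close>. In finite dimension, continuity of
  all iterated directional derivatives is the usual notion of \<open>C\<^sup>k\<close>.\<close>

primrec Ck_on :: "nat \<Rightarrow> ('a::real_normed_vector \<Rightarrow> 'b::real_normed_vector) \<Rightarrow> 'a set \<Rightarrow> bool" where
  "Ck_on 0 f U \<longleftrightarrow> continuous_on U f"
| "Ck_on (Suc k) f U \<longleftrightarrow> (\<forall>x\<in>U. f differentiable (at x)) \<and>
     (\<forall>v. Ck_on k (\<lambda>x. frechet_derivative f (at x) v) U)"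

definition smooth_on :: "('a::real_normed_vector \<Rightarrow> 'b::real_normed_vector) \<Rightarrow> 'a set \<Rightarrow> bool" where
  "smooth_on f U \<longleftrightarrow> (\<forall>k. Ck_on k f U)"

text \<open>A real analytic function is locally the (unconditionally convergent) sum of a power series
  \<open>\<Sum>\<^sub>\<alpha> c\<^sub>\<alpha> (x - p)\<^sup>\<alpha>\<close>. The multi-indices \<open>\<alpha>\<close> are functions from the basis to the naturals,
  set to zero outside the basis so that each one occurs exactly once.\<close>

definition real_analytic_on :: "('a::euclidean_space \<Rightarrow> real) \<Rightarrow> 'a set \<Rightarrow> bool" where
  "real_analytic_on f U \<longleftrightarrow>
     (\<forall>p\<in>U. \<exists>c :: ('a \<Rightarrow> nat) \<Rightarrow> real. \<exists>r>0. \<forall>x\<in>ball p r.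
        ((\<lambda>\<alpha>. c \<alpha> * (\<Prod>b\<in>Basis. ((x - p) \<bullet> b) ^ \<alpha> b)) has_sum f x)
          {\<alpha>. \<forall>b. b \<notin> Basis \<longrightarrow> \<alpha> b = 0})"

section \<open>Connections on the tangent bundle of an open subset of the vector space\<close>

text \<open>The tangent bundle of an open set \<open>U \<subseteq> V\<close> is \<open>U \<times> V\<close>, so a smooth vector field on \<open>U\<close> is a
  map \<open>V \<Rightarrow> V\<close> that is smooth on \<open>U\<close>; its values outside \<open>U\<close> are irrelevant.\<close>

definition vector_field_on :: "'a::euclidean_space set \<Rightarrow> ('a \<Rightarrow> 'a) \<Rightarrow> bool" where
  "vector_field_on U X \<longleftrightarrow> smooth_on X U"

definition dir_deriv ::
    "('a::real_normed_vector \<Rightarrow> 'a) \<Rightarrow> ('a \<Rightarrow> 'b::real_normed_vector) \<Rightarrow> 'a \<Rightarrow> 'b" where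
  "dir_deriv X f = (\<lambda>p. frechet_derivative f (at p) (X p))"

definition lie_bracket :: "('a::real_normed_vector \<Rightarrow> 'a) \<Rightarrow> ('a \<Rightarrow> 'a) \<Rightarrow> 'a \<Rightarrow> 'a" where
  "lie_bracket X Y = (\<lambda>p. dir_deriv X Y p - dir_deriv Y X p)"

text \<open>\<open>D X Y\<close> is \<open>\<nabla>\<^sub>X Y\<close>. That \<open>D X Y\<close> on \<open>U\<close> depends only on the restrictions of \<open>X\<close> and \<open>Y\<close> to
  \<open>U\<close> is a consequence of the axioms: take for \<open>f\<close> the indicator function of \<open>U\<close>.\<close>

definition connection_on ::
    "'a::euclidean_space set \<Rightarrow> (('a \<Rightarrow> 'a) \<Rightarrow> ('a \<Rightarrow> 'a) \<Rightarrow> 'a \<Rightarrow> 'a) \<Rightarrow> bool" where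
  "connection_on U D \<longleftrightarrow>
     (\<forall>X Y. vector_field_on U X \<longrightarrow> vector_field_on U Y \<longrightarrow> vector_field_on U (D X Y)) \<and>
     (\<forall>X X' Y. vector_field_on U X \<longrightarrow> vector_field_on U X' \<longrightarrow> vector_field_on U Y \<longrightarrow>
        (\<forall>p\<in>U. D (\<lambda>q. X q + X' q) Y p = D X Y p + D X' Y p)) \<and>
     (\<forall>f X Y. smooth_on (f :: 'a \<Rightarrow> real) U \<longrightarrow> vector_field_on U X \<longrightarrow> vector_field_on U Y \<longrightarrow>
        (\<forall>p\<in>U. D (\<lambda>q. f q *\<^sub>R X q) Y p = f p *\<^sub>R D X Y p)) \<and>
     (\<forall>X Y Y'. vector_field_on U X \<longrightarrow> vector_field_on U Y \<longrightarrow> vector_field_on U Y' \<longrightarrow>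
        (\<forall>p\<in>U. D X (\<lambda>q. Y q + Y' q) p = D X Y p + D X Y' p)) \<and>
     (\<forall>f X Y. smooth_on (f :: 'a \<Rightarrow> real) U \<longrightarrow> vector_field_on U X \<longrightarrow> vector_field_on U Y \<longrightarrow>
        (\<forall>p\<in>U. D X (\<lambda>q. f q *\<^sub>R Y q) p = dir_deriv X f p *\<^sub>R Y p + f p *\<^sub>R D X Y p))"

definition torsion_free_on ::
    "'a::euclidean_space set \<Rightarrow> (('a \<Rightarrow> 'a) \<Rightarrow> ('a \<Rightarrow> 'a) \<Rightarrow> 'a \<Rightarrow> 'a) \<Rightarrow> bool" where
  "torsion_free_on U D \<longleftrightarrow>
     (\<forall>X Y. vector_field_on U X \<longrightarrow> vector_field_on U Y \<longrightarrow>
        (\<forall>p\<in>U. D X Y p - D Y X p = lie_bracket X Y p))"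

definition christoffel ::
    "(('a::euclidean_space \<Rightarrow> 'a) \<Rightarrow> ('a \<Rightarrow> 'a) \<Rightarrow> 'a \<Rightarrow> 'a) \<Rightarrow> 'a \<Rightarrow> 'a \<Rightarrow> 'a \<Rightarrow> 'a \<Rightarrow> real" where
  "christoffel D i j k = (\<lambda>p. D (\<lambda>_. i) (\<lambda>_. j) p \<bullet> k)"

text \<open>The standard basis suffices: Christoffel symbols in two systems of linear coordinates differ
  by constant linear combinations.\<close>

definition real_analytic_connection_on ::
    "'a::euclidean_space set \<Rightarrow> (('a \<Rightarrow> 'a) \<Rightarrow> ('a \<Rightarrow> 'a) \<Rightarrow> 'a \<Rightarrow> 'a) \<Rightarrow> bool" where
  "real_analytic_connection_on U D \<longleftrightarrow>
     connection_on U D \<and>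
     (\<forall>i\<in>Basis. \<forall>j\<in>Basis. \<forall>k\<in>Basis. real_analytic_on (christoffel D i j k) U)"

definition curvature ::
    "(('a::euclidean_space \<Rightarrow> 'a) \<Rightarrow> ('a \<Rightarrow> 'a) \<Rightarrow> 'a \<Rightarrow> 'a) \<Rightarrow>
     ('a \<Rightarrow> 'a) \<Rightarrow> ('a \<Rightarrow> 'a) \<Rightarrow> ('a \<Rightarrow> 'a) \<Rightarrow> 'a \<Rightarrow> 'a" where
  "curvature D X Y Z = (\<lambda>p. D X (D Y Z) p - D Y (D X Z) p - D (lie_bracket X Y) Z p)"

text \<open>For a connection on \<open>U\<close>, the curvature is tensorial, so its value at a point \<open>P\<close> of \<open>U\<close> can be
  computed with any extension of the tangent vectors at \<open>P\<close> to vector fields; we take the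
  constant ones.\<close>

definition curvature_at ::
    "(('a::euclidean_space \<Rightarrow> 'a) \<Rightarrow> ('a \<Rightarrow> 'a) \<Rightarrow> 'a \<Rightarrow> 'a) \<Rightarrow> 'a \<Rightarrow> 'a \<Rightarrow> 'a \<Rightarrow> 'a \<Rightarrow> 'a" where
  "curvature_at D P x y z = curvature D (\<lambda>_. x) (\<lambda>_. y) (\<lambda>_. z) P"

definition ricci_flat_on ::
    "'a::euclidean_space set \<Rightarrow> (('a \<Rightarrow> 'a) \<Rightarrow> ('a \<Rightarrow> 'a) \<Rightarrow> 'a \<Rightarrow> 'a) \<Rightarrow> bool" where
  "ricci_flat_on U D \<longleftrightarrow> (\<forall>P\<in>U. ricci_flat_operator (curvature_at D P))"

end

theory Submission
  imports Defs "HOL-Library.Function_Algebras"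
begin

text \<open>In a gauge where the Christoffel symbols satisfy \<open>\<Sum>\<^sub>k \<Gamma>\<^sub>k\<^sub>j\<^sup>k = 0\<close>, Ricci flatness reads
  \<open>\<Sum>\<^sub>k \<partial>\<^sub>k \<Gamma>\<^sub>i\<^sub>j\<^sup>k = \<Sum>\<^sub>a\<^sub>b \<Gamma>\<^sub>i\<^sub>a\<^sup>b \<Gamma>\<^sub>j\<^sub>b\<^sup>a\<close>. Start with the linear symbols
  \<open>\<Gamma>(x)(y, z) = (A(x,y)z + A(x,z)y) / 3\<close>, which have the right curvature at \<open>0\<close> and, as \<open>A\<close> is Ricci flat,
  vanishing trace and divergence. Since \<open>m \<ge> 3\<close>, every pair \<open>i, j\<close> admits an index \<open>k\<close> different from
  both; the quadratic right-hand side is integrated in the direction \<open>x\<^sub>k\<close> and added to \<open>\<Gamma>\<^sub>i\<^sub>j\<^sup>k\<close> only, which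
  does not affect the trace. The resulting fixed point equation determines the power series coefficients
  recursively by degree, and a norm estimate on the partial sums gives convergence.\<close>

section \<open>Power series in several variables\<close>

text \<open>Ricci flatness prescribes only a divergence for each pair \<open>i, j\<close>, so the
  system is underdetermined and one component per pair can absorb the whole right-hand side. The
  obstacle is that the correction has to respect both the symmetry in \<open>i, j\<close> and the
  trace condition. The trace sees only components whose upper index equals a lower one, hence the
  demand that \<open>k\<close> avoid \<open>{i, j}\<close>; in dimension two no such index exists
  for distinct \<open>i, j\<close>. The right-hand side contains no derivatives of the symbols, so
  solving means integrating in one variable. Integration divides coefficients by positive integers
  and raises the degree, and a weighted sum of absolute values, which is submultiplicative, then
  suffices for convergence; no Cauchy-Kovalevskaya theorem is involved. The curvature at the origin
  survives the correction: the symbols vanish there, so the quadratic term has no part of degree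
  below two and its integral none of degree below three, which leaves the first derivatives at 0
  unchanged.\<close>

definition multi_indices :: "('a::euclidean_space \<Rightarrow> nat) set" where
  "multi_indices = {\<alpha>. \<forall>b. b \<notin> Basis \<longrightarrow> \<alpha> b = 0}"

definition deg :: "('a::euclidean_space \<Rightarrow> nat) \<Rightarrow> nat" where
  "deg \<alpha> = (\<Sum>b\<in>Basis. \<alpha> b)"

definition unit_index :: "'a \<Rightarrow> 'a \<Rightarrow> nat" where
  "unit_index k = (\<lambda>b. if b = k then 1 else 0)"

definition mon :: "'a::euclidean_space \<Rightarrow> ('a \<Rightarrow> nat) \<Rightarrow> real" where
  "mon x \<alpha> = (\<Prod>b\<in>Basis. (x \<bullet> b) ^ \<alpha> b)"

definition power_series :: "(('a::euclidean_space \<Rightarrow> nat) \<Rightarrow> real) \<Rightarrow> 'a \<Rightarrow> real" where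
  "power_series c x = (\<Sum>\<^sub>\<infinity>\<alpha>\<in>multi_indices. c \<alpha> * mon x \<alpha>)"

lemma zero_in_multi_indices [simp]: "0 \<in> multi_indices"
  by (simp add: multi_indices_def)

lemma unit_index_in_multi_indices [simp]: "k \<in> Basis \<Longrightarrow> unit_index k \<in> multi_indices"
  by (auto simp: multi_indices_def unit_index_def)

lemma add_in_multi_indices [simp]:
  "\<alpha> \<in> multi_indices \<Longrightarrow> \<beta> \<in> multi_indices \<Longrightarrow> \<alpha> + \<beta> \<in> multi_indices"
  by (auto simp: multi_indices_def)

lemma diff_in_multi_indices [simp]: "\<alpha> \<in> multi_indices \<Longrightarrow> \<alpha> - \<beta> \<in> multi_indices"
  by (auto simp: multi_indices_def)

lemma multi_indices_downward: "\<alpha> \<in> multi_indices \<Longrightarrow> \<beta> \<le> \<alpha> \<Longrightarrow> \<beta> \<in> multi_indices"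
  by (auto simp: multi_indices_def le_fun_def) (metis le_zero_eq)

lemma index_add_diff [simp]: "\<beta> \<le> (\<alpha> :: 'a \<Rightarrow> nat) \<Longrightarrow> \<alpha> - \<beta> + \<beta> = \<alpha>"
  "\<beta> \<le> (\<alpha> :: 'a \<Rightarrow> nat) \<Longrightarrow> \<beta> + (\<alpha> - \<beta>) = \<alpha>"
  by (auto simp: le_fun_def fun_eq_iff)

lemma index_diff_le: "\<alpha> - \<beta> \<le> (\<alpha> :: 'a \<Rightarrow> nat)"
  by (simp add: le_fun_def)

lemma unit_index_self [simp]: "unit_index k k = 1"
  by (simp add: unit_index_def)

lemma unit_index_eq_iff [simp]: "unit_index k = unit_index l \<longleftrightarrow> k = l"
  by (auto simp: unit_index_def fun_eq_iff split: if_splits)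

lemma unit_index_le_iff: "unit_index k \<le> \<alpha> \<longleftrightarrow> 0 < \<alpha> k"
  by (auto simp: unit_index_def le_fun_def Suc_le_eq)

lemma deg_zero [simp]: "deg 0 = 0"
  by (simp add: deg_def)

lemma deg_add [simp]: "deg (\<alpha> + \<beta>) = deg \<alpha> + deg \<beta>"
  by (simp add: deg_def sum.distrib)

lemma deg_unit_index [simp]: "k \<in> Basis \<Longrightarrow> deg (unit_index k) = 1"
  by (simp add: deg_def unit_index_def)

lemma deg_diff_unit_index:
  assumes "k \<in> Basis" "0 < \<alpha> k"
  shows "Suc (deg (\<alpha> - unit_index k)) = deg \<alpha>"
  using deg_add[of "\<alpha> - unit_index k" "unit_index k"] assms by (simp add: unit_index_le_iff)

lemma deg_mono: "\<alpha> \<le> \<beta> \<Longrightarrow> deg \<alpha> \<le> deg \<beta>"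
  by (simp add: deg_def sum_mono le_fun_def)

lemma index_le_deg: "b \<in> Basis \<Longrightarrow> \<alpha> b \<le> deg \<alpha>"
  unfolding deg_def by (rule member_le_sum) auto

lemma deg_eq_0_iff: "\<alpha> \<in> multi_indices \<Longrightarrow> deg \<alpha> = 0 \<longleftrightarrow> \<alpha> = 0"
  by (auto simp: deg_def multi_indices_def fun_eq_iff)

lemma finite_deg_le: "finite {\<alpha> \<in> multi_indices. deg \<alpha> \<le> n}"
proof (rule finite_subset)
  show "{\<alpha> \<in> multi_indices. deg \<alpha> \<le> n}
      \<subseteq> {f. \<forall>x::'a. (x \<in> Basis \<longrightarrow> f x \<in> {..n}) \<and> (x \<notin> Basis \<longrightarrow> f x = 0)}"
    by (auto simp: multi_indices_def intro: order_trans[OF index_le_deg])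
qed (intro finite_set_of_finite_funs; simp)

lemma finite_index_atMost: "\<alpha> \<in> multi_indices \<Longrightarrow> finite {..\<alpha>}"
  by (rule finite_subset[OF _ finite_deg_le[of "deg \<alpha>"]])
     (auto intro: multi_indices_downward deg_mono)

lemma deg_eq_1:
  assumes "\<alpha> \<in> multi_indices" "deg \<alpha> = 1"
  shows "\<exists>k\<in>Basis. \<alpha> = unit_index k"
proof -
  from assms obtain k where k: "k \<in> Basis" "0 < \<alpha> k"
    by (metis One_nat_def deg_def gr0I sum.neutral zero_neq_one)
  then have le: "unit_index k \<le> \<alpha>" by (simp add: unit_index_le_iff)
  then have "deg (\<alpha> - unit_index k) + deg (unit_index k) = 1"
    using assms deg_add[of "\<alpha> - unit_index k" "unit_index k"] by simp
  then have "\<alpha> - unit_index k = 0"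
    using k assms by (simp add: deg_eq_0_iff)
  then have "\<alpha> = unit_index k"
    using le by (metis add_0 index_add_diff(1))
  with k show ?thesis by blast
qed

lemma mon_zero [simp]: "mon x 0 = 1"
  by (simp add: mon_def)

lemma mon_unit_index [simp]: "k \<in> Basis \<Longrightarrow> mon x (unit_index k) = x \<bullet> k"
  by (simp add: mon_def unit_index_def if_distrib cong: if_cong)

lemma mon_add: "mon x (\<alpha> + \<beta>) = mon x \<alpha> * mon x \<beta>"
  by (simp add: mon_def power_add prod.distrib)

lemma mon_at_zero: "\<alpha> \<in> multi_indices \<Longrightarrow> mon 0 \<alpha> = (if \<alpha> = 0 then 1 else 0)"
  by (auto simp: mon_def multi_indices_def fun_eq_iff)

lemma mon_le_power_deg:
  assumes "\<And>b. b \<in> Basis \<Longrightarrow> \<bar>x \<bullet> b\<bar> \<le> R"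
  shows "\<bar>mon x \<alpha>\<bar> \<le> R ^ deg \<alpha>"
  unfolding mon_def deg_def power_sum abs_prod power_abs
  by (rule prod_mono) (auto intro: power_mono assms)

definition index_binomial :: "('a::euclidean_space \<Rightarrow> nat) \<Rightarrow> ('a \<Rightarrow> nat) \<Rightarrow> real" where
  "index_binomial \<alpha> \<beta> = (\<Prod>b\<in>Basis. real (\<alpha> b choose \<beta> b))"

lemma index_binomial_nonneg: "0 \<le> index_binomial \<alpha> \<beta>"
  by (simp add: index_binomial_def prod_nonneg)

text \<open>Stated for arbitrary factors and not for \<open>mon\<close>, because it is applied both
  to signed coordinates (the expansion itself) and to their absolute values (its majorant).\<close>

lemma prod_binomial:
  fixes f g :: "'a::euclidean_space \<Rightarrow> real"
  assumes "\<alpha> \<in> multi_indices"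
  shows "(\<Prod>b\<in>Basis. (f b + g b) ^ \<alpha> b) = (\<Sum>\<beta>\<in>{..\<alpha>}. index_binomial \<alpha> \<beta> *
           (\<Prod>b\<in>Basis. f b ^ (\<alpha> - \<beta>) b) * (\<Prod>b\<in>Basis. g b ^ \<beta> b))"
proof -
  let ?t = "\<lambda>b n. real (\<alpha> b choose n) * f b ^ (\<alpha> b - n) * g b ^ n"
  have "(\<Prod>b\<in>Basis. (f b + g b) ^ \<alpha> b) = (\<Prod>b\<in>Basis. \<Sum>n\<le>\<alpha> b. ?t b n)"
    by (intro prod.cong refl, subst add.commute, subst binomial_ring) (simp add: ac_simps)
  also have "\<dots> = (\<Sum>h\<in>PiE Basis (\<lambda>b. {..\<alpha> b}). \<Prod>b\<in>Basis. ?t b (h b))"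
    by (rule prod_sum_PiE) auto
  \<comment> \<open>Choice functions in \<open>PiE\<close> are \<open>undefined\<close> off
    \<open>Basis\<close>, multi-indices are 0 there; the bijection trades one default for the
    other.\<close>
  also have "\<dots> = (\<Sum>\<beta>\<in>{..\<alpha>}. \<Prod>b\<in>Basis. ?t b (\<beta> b))"
  proof (rule sum.reindex_bij_witness[where j = "\<lambda>h b. if b \<in> Basis then h b else 0"
        and i = "\<lambda>\<beta>. restrict \<beta> Basis"])
    fix \<beta> assume "\<beta> \<in> {..\<alpha>}"
    then show "(\<lambda>b. if b \<in> Basis then restrict \<beta> Basis b else 0) = \<beta>"
      using multi_indices_downward[OF assms] by (auto simp: multi_indices_def fun_eq_iff)
  qed (auto simp: le_fun_def PiE_iff extensional_def fun_eq_iff)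
  finally show ?thesis
    by (simp add: index_binomial_def prod.distrib)
qed

text \<open>The coefficients of the Cauchy product of two power series.\<close>

definition index_convolution ::
    "(('a \<Rightarrow> nat) \<Rightarrow> real) \<Rightarrow> (('a \<Rightarrow> nat) \<Rightarrow> real) \<Rightarrow> ('a \<Rightarrow> nat) \<Rightarrow> real" where
  "index_convolution c d \<alpha> = (\<Sum>\<beta>\<in>{..\<alpha>}. c \<beta> * d (\<alpha> - \<beta>))"

lemma index_convolution_commute: "index_convolution c d \<alpha> = index_convolution d c \<alpha>"
  unfolding index_convolution_def
  by (rule sum.reindex_bij_witness[where i = "\<lambda>\<beta>. \<alpha> - \<beta>" and j = "\<lambda>\<beta>. \<alpha> - \<beta>"])
     (auto simp: le_fun_def fun_eq_iff intro!: arg_cong[where f = c])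

section \<open>Absolute convergence on polydiscs\<close>

definition polydisc :: "real \<Rightarrow> 'a::euclidean_space set" where
  "polydisc r = {x. \<forall>b\<in>Basis. \<bar>x \<bullet> b\<bar> < r}"

text \<open>Demanding summability only for radii strictly below \<open>r\<close> lets termwise
  differentiation keep the same \<open>r\<close>: the loss is paid out of the gap between
  \<open>s\<close> and \<open>r\<close>.\<close>

definition converges :: "(('a::euclidean_space \<Rightarrow> nat) \<Rightarrow> real) \<Rightarrow> real \<Rightarrow> bool" where
  "converges c r \<longleftrightarrow> (\<forall>s. 0 \<le> s \<and> s < r \<longrightarrow> (\<lambda>\<alpha>. \<bar>c \<alpha>\<bar> * s ^ deg \<alpha>) summable_on multi_indices)"

lemma open_polydisc: "open (polydisc r :: 'a::euclidean_space set)"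
proof -
  have "polydisc r = box (- r *\<^sub>R One) (r *\<^sub>R One :: 'a)"
    by (auto simp: polydisc_def box_def abs_less_iff minus_less_iff)
  then show ?thesis by (simp add: open_box)
qed

lemma polydisc_bound:
  assumes "(x :: 'a::euclidean_space) \<in> polydisc r"
  obtains s where "0 \<le> s" "s < r" "\<And>b. b \<in> Basis \<Longrightarrow> \<bar>x \<bullet> b\<bar> \<le> s"
proof
  let ?s = "Max ((\<lambda>b. \<bar>x \<bullet> b\<bar>) ` Basis)"
  show le: "\<bar>x \<bullet> b\<bar> \<le> ?s" if "b \<in> Basis" for b
    using that by (intro Max_ge) auto
  obtain b :: 'a where "b \<in> Basis" using nonempty_Basis by blast
  from le[OF this] show "0 \<le> ?s" by linarith
  show "?s < r" using assms by (simp add: polydisc_def)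
qed

lemma power_series_abs_summable:
  assumes "converges c r" "x \<in> polydisc r"
  shows "Infinite_Sum.abs_summable_on (\<lambda>\<alpha>. c \<alpha> * mon x \<alpha>) multi_indices"
proof -
  obtain s where s: "0 \<le> s" "s < r" "\<And>b. b \<in> Basis \<Longrightarrow> \<bar>x \<bullet> b\<bar> \<le> s"
    using polydisc_bound[OF assms(2)] by blast
  have "(\<lambda>\<alpha>. \<bar>c \<alpha>\<bar> * s ^ deg \<alpha>) summable_on multi_indices"
    using assms(1) s by (auto simp: converges_def)
  then show ?thesis
    by (rule summable_on_comparison_test)
       (auto simp: abs_mult intro!: mult_left_mono mon_le_power_deg s)
qed

lemma power_series_has_sum:
  assumes "converges c r" "x \<in> polydisc r"
  shows "((\<lambda>\<alpha>. c \<alpha> * mon x \<alpha>) has_sum power_series c x) multi_indices"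
  unfolding power_series_def
  by (rule has_sum_infsum[OF abs_summable_summable[OF power_series_abs_summable[OF assms]]])

text \<open>The double series over pairs of multi-indices is absolutely summable, so it may be
  regrouped by the sum of the two indices; the pairs with sum \<alpha> are
  \<open>(\<beta>, \<alpha> - \<beta>)\<close> with \<beta> \<le> \<alpha>.\<close>

lemma power_series_mult:
  assumes c: "converges c r" and d: "converges d r" and x: "x \<in> polydisc r"
  shows "((\<lambda>\<alpha>. index_convolution c d \<alpha> * mon x \<alpha>) has_sum
            power_series c x * power_series d x) multi_indices"
proof -
  let ?f = "\<lambda>\<beta>. c \<beta> * mon x \<beta>" and ?g = "\<lambda>\<gamma>. d \<gamma> * mon x \<gamma>"
  let ?h = "\<lambda>(\<beta>, \<gamma>). ?f \<beta> * ?g \<gamma>"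
  have "Infinite_Sum.abs_summable_on ?h (multi_indices \<times> multi_indices)"
  proof (rule summable_on_SigmaI)
    fix \<beta>
    show "((\<lambda>\<gamma>. norm (?h (\<beta>, \<gamma>))) has_sum
        norm (?f \<beta>) * infsum (\<lambda>\<gamma>. norm (?g \<gamma>)) multi_indices) multi_indices"
      unfolding split norm_mult[of "?f \<beta>"]
      by (intro has_sum_cmult_right has_sum_infsum power_series_abs_summable[OF d x])
  next
    show "(\<lambda>\<beta>. norm (?f \<beta>) * infsum (\<lambda>\<gamma>. norm (?g \<gamma>)) multi_indices) summable_on multi_indices"
      by (rule summable_on_cmult_left[OF power_series_abs_summable[OF c x]])
  qed (rule norm_ge_zero)
  then have "?h summable_on multi_indices \<times> multi_indices"
    by (rule abs_summable_summable)
  then have "(?h has_sum power_series c x * power_series d x) (multi_indices \<times> multi_indices)"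
  proof (rule has_sum_SigmaI[rotated -1])
    show "((\<lambda>\<gamma>. ?h (\<beta>, \<gamma>)) has_sum ?f \<beta> * power_series d x) multi_indices" for \<beta>
      unfolding split by (rule has_sum_cmult_right[OF power_series_has_sum[OF d x]])
    show "((\<lambda>\<beta>. ?f \<beta> * power_series d x) has_sum power_series c x * power_series d x) multi_indices"
      by (rule has_sum_cmult_left[OF power_series_has_sum[OF c x]])
  qed
  also have "?this \<longleftrightarrow> ((\<lambda>(\<alpha>, \<beta>). ?h (\<beta>, \<alpha> - \<beta>)) has_sum power_series c x * power_series d x)
      (Sigma multi_indices atMost)"
    by (rule has_sum_reindex_bij_witness[where i = "\<lambda>(\<alpha>, \<beta>). (\<beta>, \<alpha> - \<beta>)"
          and j = "\<lambda>(\<beta>, \<gamma>). (\<beta> + \<gamma>, \<beta>)"])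
       (auto simp: le_fun_def intro: multi_indices_downward)
  finally show ?thesis
  proof (rule has_sum_SigmaD)
    fix \<alpha> :: "'a \<Rightarrow> nat" assume \<alpha>: "\<alpha> \<in> multi_indices"
    have "index_convolution c d \<alpha> * mon x \<alpha> = (\<Sum>\<beta>\<in>{..\<alpha>}. ?h (\<beta>, \<alpha> - \<beta>))"
      unfolding index_convolution_def sum_distrib_right
    proof (rule sum.cong)
      fix \<beta> assume "\<beta> \<in> {..\<alpha>}"
      then have "mon x \<alpha> = mon x \<beta> * mon x (\<alpha> - \<beta>)"
        by (simp flip: mon_add)
      then show "c \<beta> * d (\<alpha> - \<beta>) * mon x \<alpha> = ?h (\<beta>, \<alpha> - \<beta>)" by simp
    qed simp
    with \<alpha> show "((\<lambda>\<beta>. case (\<alpha>, \<beta>) of (\<alpha>, \<beta>) \<Rightarrow> ?h (\<beta>, \<alpha> - \<beta>)) has_sum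
        index_convolution c d \<alpha> * mon x \<alpha>) {..\<alpha>}"
      by (simp add: has_sum_finiteI finite_index_atMost)
  qed
qed

text \<open>The hypothesis is \<open>has_sum\<close> at one point and not \<open>converges\<close>,
  so that products obtained from \<open>power_series_mult\<close> can be summed as well.\<close>

lemma power_series_sum:
  assumes "finite S" "\<And>b. b \<in> S \<Longrightarrow> ((\<lambda>\<alpha>. c b \<alpha> * mon x \<alpha>) has_sum s b) multi_indices"
  shows "((\<lambda>\<alpha>. (\<Sum>b\<in>S. c b \<alpha>) * mon x \<alpha>) has_sum (\<Sum>b\<in>S. s b)) multi_indices"
  using assms
proof (induction S)
  case (insert b S)
  then have "((\<lambda>\<alpha>. c b \<alpha> * mon x \<alpha> + (\<Sum>b\<in>S. c b \<alpha>) * mon x \<alpha>) has_sum s b + (\<Sum>b\<in>S. s b)) multi_indices"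
    by (intro has_sum_add) auto
  with insert.hyps show ?case by (simp add: distrib_right)
qed simp

lemma power_series_sum_eq_0:
  fixes x :: "'a::euclidean_space"
  assumes "\<And>b. b \<in> Basis \<Longrightarrow> converges (c b) r" "x \<in> polydisc r"
    and "\<And>\<alpha>. (\<Sum>b\<in>Basis. c b \<alpha>) = 0"
  shows "(\<Sum>b\<in>Basis. power_series (c b) x) = 0"
proof -
  have "((\<lambda>\<alpha>. (\<Sum>b\<in>Basis. c b \<alpha>) * mon x \<alpha>) has_sum (\<Sum>b\<in>Basis. power_series (c b) x)) multi_indices"
    by (intro power_series_sum power_series_has_sum[OF assms(1,2)]) auto
  then have "((\<lambda>_. 0) has_sum (\<Sum>b\<in>Basis. power_series (c b) x)) (multi_indices :: ('a \<Rightarrow> nat) set)"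
    by (simp add: assms(3))
  from has_sum_unique[OF this has_sum_0] show ?thesis by simp
qed

lemma power_series_at_0: "power_series c 0 = c 0"
proof -
  have "power_series c 0 = infsum c {0}"
    unfolding power_series_def by (rule infsum_cong_neutral) (auto simp: mon_at_zero)
  then show ?thesis by simp
qed

section \<open>Recentring a power series at another point\<close>

definition recenter :: "(('a::euclidean_space \<Rightarrow> nat) \<Rightarrow> real) \<Rightarrow> 'a \<Rightarrow> ('a \<Rightarrow> nat) \<Rightarrow> real" where
  "recenter c p \<beta> =
     (\<Sum>\<^sub>\<infinity>\<alpha>\<in>{\<alpha>\<in>multi_indices. \<beta> \<le> \<alpha>}. c \<alpha> * index_binomial \<alpha> \<beta> * mon p (\<alpha> - \<beta>))"

context
  fixes c :: "('a::euclidean_space \<Rightarrow> nat) \<Rightarrow> real" and p :: 'a and \<rho> r s :: real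
  assumes c: "converges c r" and s: "s < r"
    and p: "\<And>b. b \<in> Basis \<Longrightarrow> \<bar>p \<bullet> b\<bar> + \<rho> \<le> s"
begin

text \<open>For fixed \<alpha> the absolute values of the binomial terms add up to
  \<open>\<bar>c \<alpha>\<bar>\<close> times the product of the \<open>(\<bar>p \<bullet> b\<bar> +
  \<bar>y \<bullet> b\<bar>) ^ \<alpha> b\<close>. Each base is at most \<open>s\<close>, which is
  below the convergence radius, so the original series at radius \<open>s\<close> dominates.\<close>

lemma recenter_abs_summable:
  assumes y: "\<And>b. b \<in> Basis \<Longrightarrow> \<bar>y \<bullet> b\<bar> \<le> \<rho>"
  shows "Infinite_Sum.abs_summable_on
           (\<lambda>(\<alpha>, \<beta>). c \<alpha> * index_binomial \<alpha> \<beta> * mon p (\<alpha> - \<beta>) * mon y \<beta>)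
           (Sigma multi_indices atMost)"
    (is "Infinite_Sum.abs_summable_on ?F _")
proof -
  obtain b0 :: 'a where "b0 \<in> Basis" using nonempty_Basis by blast
  with p y have "0 \<le> s" by (meson abs_ge_zero add_nonneg_nonneg order_trans)
  have pt: "norm (?F (\<alpha>, \<beta>)) = \<bar>c \<alpha>\<bar> * (index_binomial \<alpha> \<beta> *
      (\<Prod>b\<in>Basis. \<bar>p \<bullet> b\<bar> ^ (\<alpha> - \<beta>) b) * (\<Prod>b\<in>Basis. \<bar>y \<bullet> b\<bar> ^ \<beta> b))" for \<alpha> \<beta>
    by (simp add: mon_def abs_mult abs_prod power_abs index_binomial_nonneg)
  have inner: "((\<lambda>\<beta>. norm (?F (\<alpha>, \<beta>))) has_sum
      \<bar>c \<alpha>\<bar> * (\<Prod>b\<in>Basis. (\<bar>p \<bullet> b\<bar> + \<bar>y \<bullet> b\<bar>) ^ \<alpha> b)) {..\<alpha>}" if "\<alpha> \<in> multi_indices" for \<alpha>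
    unfolding pt prod_binomial[OF that] sum_distrib_left
    using that by (intro has_sum_finiteI finite_index_atMost refl)
  have "(\<lambda>\<alpha>. \<bar>c \<alpha>\<bar> * s ^ deg \<alpha>) summable_on multi_indices"
    using c s \<open>0 \<le> s\<close> by (simp add: converges_def)
  then have outer: "(\<lambda>\<alpha>. \<bar>c \<alpha>\<bar> * (\<Prod>b\<in>Basis. (\<bar>p \<bullet> b\<bar> + \<bar>y \<bullet> b\<bar>) ^ \<alpha> b)) summable_on multi_indices"
  proof (rule summable_on_comparison_test)
    fix \<alpha> :: "'a \<Rightarrow> nat"
    have "(\<Prod>b\<in>Basis. (\<bar>p \<bullet> b\<bar> + \<bar>y \<bullet> b\<bar>) ^ \<alpha> b) \<le> s ^ deg \<alpha>"
      unfolding deg_def power_sum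
    proof (rule prod_mono, intro conjI power_mono)
      fix b :: 'a assume "b \<in> Basis"
      from p[OF this] y[OF this] show "\<bar>p \<bullet> b\<bar> + \<bar>y \<bullet> b\<bar> \<le> s" by linarith
    qed auto
    then show "\<bar>c \<alpha>\<bar> * (\<Prod>b\<in>Basis. (\<bar>p \<bullet> b\<bar> + \<bar>y \<bullet> b\<bar>) ^ \<alpha> b) \<le> \<bar>c \<alpha>\<bar> * s ^ deg \<alpha>"
      by (simp add: mult_left_mono)
  qed (auto intro!: mult_nonneg_nonneg prod_nonneg)
  show ?thesis
    by (rule summable_on_SigmaI[OF inner outer]) auto
qed

lemma recenter_abs_summable_swapped:
  assumes y: "\<And>b. b \<in> Basis \<Longrightarrow> \<bar>y \<bullet> b\<bar> \<le> \<rho>"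
  shows "Infinite_Sum.abs_summable_on
           (\<lambda>(\<beta>, \<alpha>). c \<alpha> * index_binomial \<alpha> \<beta> * mon p (\<alpha> - \<beta>) * mon y \<beta>)
           (SIGMA \<beta>:multi_indices. {\<alpha>\<in>multi_indices. \<beta> \<le> \<alpha>})"
proof -
  let ?F = "\<lambda>(\<alpha>, \<beta>). c \<alpha> * index_binomial \<alpha> \<beta> * mon p (\<alpha> - \<beta>) * mon y \<beta>"
  have "Infinite_Sum.abs_summable_on ?F (Sigma multi_indices atMost)"
    by (rule recenter_abs_summable[OF y])
  also have "?this \<longleftrightarrow> ?thesis"
    by (rule summable_on_reindex_bij_witness[where i = prod.swap and j = prod.swap])
       (auto intro: multi_indices_downward)
  finally show ?thesis .
qed

text \<open>One absolutely summable double series is summed in two orders: over \<beta> first, the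
  binomial expansion returns the terms of the series at \<open>p + y\<close>; over \<alpha> first,
  the Taylor coefficients at \<open>p\<close> appear.\<close>

lemma recenter_has_sum:
  assumes y: "\<And>b. b \<in> Basis \<Longrightarrow> \<bar>y \<bullet> b\<bar> \<le> \<rho>"
  shows "((\<lambda>\<beta>. recenter c p \<beta> * mon y \<beta>) has_sum power_series c (p + y)) multi_indices"
proof -
  let ?F = "\<lambda>(\<alpha>, \<beta>). c \<alpha> * index_binomial \<alpha> \<beta> * mon p (\<alpha> - \<beta>) * mon y \<beta>"
  let ?G = "\<lambda>(\<beta>, \<alpha>). c \<alpha> * index_binomial \<alpha> \<beta> * mon p (\<alpha> - \<beta>) * mon y \<beta>"
  have py: "p + y \<in> polydisc r"
    unfolding polydisc_def
  proof (intro CollectI ballI)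
    fix b :: 'a assume "b \<in> Basis"
    from p[OF this] y[OF this] s show "\<bar>(p + y) \<bullet> b\<bar> < r"
      unfolding inner_add_left by linarith
  qed
  have G: "Infinite_Sum.abs_summable_on ?G (SIGMA \<beta>:multi_indices. {\<alpha>\<in>multi_indices. \<beta> \<le> \<alpha>})"
    by (rule recenter_abs_summable_swapped[OF y])
  have "?F summable_on Sigma multi_indices atMost"
    by (rule abs_summable_summable[OF recenter_abs_summable[OF y]])
  then have "(?F has_sum power_series c (p + y)) (Sigma multi_indices atMost)"
  proof (rule has_sum_SigmaI[rotated -1])
    fix \<alpha> :: "'a \<Rightarrow> nat" assume \<alpha>: "\<alpha> \<in> multi_indices"
    have "c \<alpha> * mon (p + y) \<alpha> = (\<Sum>\<beta>\<in>{..\<alpha>}. ?F (\<alpha>, \<beta>))"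
      using prod_binomial[OF \<alpha>, of "\<lambda>b. p \<bullet> b" "\<lambda>b. y \<bullet> b"]
      by (simp add: mon_def inner_add_left sum_distrib_left mult.assoc)
    then show "((\<lambda>\<beta>. ?F (\<alpha>, \<beta>)) has_sum c \<alpha> * mon (p + y) \<alpha>) {..\<alpha>}"
      using \<alpha> by (intro has_sum_finiteI finite_index_atMost) auto
  qed (rule power_series_has_sum[OF c py])
  also have "?this \<longleftrightarrow> (?G has_sum power_series c (p + y))
      (SIGMA \<beta>:multi_indices. {\<alpha>\<in>multi_indices. \<beta> \<le> \<alpha>})"
    by (rule has_sum_reindex_bij_witness[where i = prod.swap and j = prod.swap])
       (auto intro: multi_indices_downward)
  finally show ?thesis
  proof (rule has_sum_SigmaD)
    fix \<beta> :: "'a \<Rightarrow> nat" assume "\<beta> \<in> multi_indices"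
    with G have "Infinite_Sum.abs_summable_on (\<lambda>\<alpha>. ?G (\<beta>, \<alpha>)) {\<alpha>\<in>multi_indices. \<beta> \<le> \<alpha>}"
      unfolding Infinite_Sum.abs_summable_on_Sigma_iff by blast
    then have "((\<lambda>\<alpha>. ?G (\<beta>, \<alpha>)) has_sum infsum (\<lambda>\<alpha>. ?G (\<beta>, \<alpha>)) {\<alpha>\<in>multi_indices. \<beta> \<le> \<alpha>})
        {\<alpha>\<in>multi_indices. \<beta> \<le> \<alpha>}"
      by (rule has_sum_infsum[OF abs_summable_summable])
    then show "((\<lambda>\<alpha>. ?G (\<beta>, \<alpha>)) has_sum recenter c p \<beta> * mon y \<beta>) {\<alpha>\<in>multi_indices. \<beta> \<le> \<alpha>}"
      by (simp add: recenter_def infsum_cmult_left')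
  qed
qed

text \<open>Supplies the finite constant that bounds the Taylor remainder in
  \<open>power_series_has_derivative\<close>.\<close>

lemma recenter_summable:
  assumes "0 \<le> \<rho>"
  shows "(\<lambda>\<beta>. \<bar>recenter c p \<beta>\<bar> * \<rho> ^ deg \<beta>) summable_on multi_indices"
proof -
  \<comment> \<open>At this corner of the polydisc every monomial attains its bound
    \<open>\<rho> ^ deg \<beta>\<close>, so summability at the single point \<open>y\<close> already
    gives the claim.\<close>
  define y :: 'a where "y = \<rho> *\<^sub>R One"
  have y: "b \<in> Basis \<Longrightarrow> \<bar>y \<bullet> b\<bar> \<le> \<rho>" for b
    using assms by (simp add: y_def)
  have mon_y: "mon y \<beta> = \<rho> ^ deg \<beta>" for \<beta>
    by (simp add: y_def mon_def deg_def power_sum)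
  let ?G = "\<lambda>(\<beta>, \<alpha>). c \<alpha> * index_binomial \<alpha> \<beta> * mon p (\<alpha> - \<beta>) * mon y \<beta>"
  have G: "Infinite_Sum.abs_summable_on ?G (SIGMA \<beta>:multi_indices. {\<alpha>\<in>multi_indices. \<beta> \<le> \<alpha>})"
    by (rule recenter_abs_summable_swapped[OF y])
  then have "(\<lambda>\<beta>. infsum (\<lambda>\<alpha>. norm (?G (\<beta>, \<alpha>))) {\<alpha>\<in>multi_indices. \<beta> \<le> \<alpha>}) summable_on multi_indices"
    unfolding Infinite_Sum.abs_summable_on_Sigma_iff by (rule abs_summable_summable[OF conjunct2])
  then show ?thesis
  proof (rule summable_on_comparison_test)
    fix \<beta> :: "'a \<Rightarrow> nat" assume "\<beta> \<in> multi_indices"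
    with G have "Infinite_Sum.abs_summable_on (\<lambda>\<alpha>. ?G (\<beta>, \<alpha>)) {\<alpha>\<in>multi_indices. \<beta> \<le> \<alpha>}"
      unfolding Infinite_Sum.abs_summable_on_Sigma_iff by blast
    from norm_infsum_bound[OF this]
    show "\<bar>recenter c p \<beta>\<bar> * \<rho> ^ deg \<beta> \<le> infsum (\<lambda>\<alpha>. norm (?G (\<beta>, \<alpha>))) {\<alpha>\<in>multi_indices. \<beta> \<le> \<alpha>}"
      using assms by (simp add: recenter_def infsum_cmult_left' mon_y abs_mult)
  qed (use assms in auto)
qed

end

section \<open>Smoothness and analyticity of power series\<close>

text \<open>Derivative formulas are available only at points of \<open>U\<close>. Since
  \<open>U\<close> is open, the derivative at such a point depends only on values in
  \<open>U\<close>. By symmetry one implication suffices.\<close>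

lemma Ck_on_cong:
  fixes f g :: "'a::real_normed_vector \<Rightarrow> 'b::real_normed_vector"
  assumes "open U" "\<And>x. x \<in> U \<Longrightarrow> f x = g x"
  shows "Ck_on k f U \<longleftrightarrow> Ck_on k g U"
proof -
  have "Ck_on k f U \<Longrightarrow> (\<And>x. x \<in> U \<Longrightarrow> f x = g x) \<Longrightarrow> Ck_on k g U"
    for f g :: "'a \<Rightarrow> 'b"
  proof (induction k arbitrary: f g)
    case 0
    then show ?case by (simp cong: continuous_on_cong)
  next
    case (Suc k)
    have D: "(g has_derivative frechet_derivative f (at x)) (at x)" if "x \<in> U" for x
      using that Suc.prems assms(1)
      by (intro has_derivative_transform_within_open[OF frechet_derivative_works[THEN iffD1]])
        auto
    then have "frechet_derivative f (at x) = frechet_derivative g (at x)" if "x \<in> U" for x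
      using frechet_derivative_at that by blast
    then have "Ck_on k (\<lambda>x. frechet_derivative g (at x) v) U" for v
      using Suc.prems(1) Suc.IH[of "\<lambda>x. frechet_derivative f (at x) v"] by simp
    with D show ?case by (auto simp: differentiable_def)
  qed
  from this[of f g] this[of g f] assms(2) show ?thesis by auto
qed

lemma Ck_on_SucD: "Ck_on (Suc k) f U \<Longrightarrow> Ck_on k f U"
proof (induction k arbitrary: f)
  case 0
  then show ?case
    by (auto intro!: continuous_at_imp_continuous_on differentiable_imp_continuous_within)
next
  case (Suc k)
  from Suc.prems have "Ck_on (Suc k) (\<lambda>x. frechet_derivative f (at x) v) U" for v
    by (metis Ck_on.simps(2))
  with Suc.IH have "Ck_on k (\<lambda>x. frechet_derivative f (at x) v) U" for v
    by blast
  with Suc.prems show ?case by simp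
qed

lemma Ck_on_SucI:
  assumes "open U" "\<And>x. x \<in> U \<Longrightarrow> (f has_derivative f' x) (at x)"
    "\<And>v. Ck_on k (\<lambda>x. f' x v) U"
  shows "Ck_on (Suc k) f U"
proof -
  have "f' x = frechet_derivative f (at x)" if "x \<in> U" for x
    using frechet_derivative_at assms(2) that by blast
  then have "Ck_on k (\<lambda>x. frechet_derivative f (at x) v) U" for v
    using assms(3)[of v] Ck_on_cong[OF assms(1), of "\<lambda>x. f' x v" "\<lambda>x. frechet_derivative f (at x) v"]
    by simp
  with assms(2) show ?thesis by (auto simp: differentiable_def)
qed

lemma Ck_on_const: "open U \<Longrightarrow> Ck_on k (\<lambda>x. c) U"
proof (induction k arbitrary: c)
  case (Suc k)
  show ?case
    using Suc.prems by (rule Ck_on_SucI[where f' = "\<lambda>x v. 0"]) (auto intro: Suc)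
qed simp

lemma Ck_on_has_derivative:
  "Ck_on (Suc k) f U \<Longrightarrow> x \<in> U \<Longrightarrow> (f has_derivative frechet_derivative f (at x)) (at x)"
  unfolding Ck_on.simps using frechet_derivative_works by blast

lemma Ck_on_bounded_linear:
  assumes "open U" "bounded_linear L"
  shows "Ck_on k f U \<Longrightarrow> Ck_on k (\<lambda>x. L (f x)) U"
proof (induction k arbitrary: f)
  case 0
  then show ?case using assms by (simp add: bounded_linear.continuous_on)
next
  case (Suc k)
  show ?case
  proof (rule Ck_on_SucI[OF assms(1) bounded_linear.has_derivative[OF assms(2)]])
    show "Ck_on k (\<lambda>x. L (frechet_derivative f (at x) v)) U" for v
      using Suc.prems by (intro Suc.IH) auto
  qed (rule Ck_on_has_derivative[OF Suc.prems], assumption)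
qed

lemma Ck_on_add:
  assumes "open U"
  shows "Ck_on k f U \<Longrightarrow> Ck_on k g U \<Longrightarrow> Ck_on k (\<lambda>x. f x + g x) U"
proof (induction k arbitrary: f g)
  case 0
  then show ?case by (simp add: continuous_on_add)
next
  case (Suc k)
  show ?case
  proof (rule Ck_on_SucI[OF assms has_derivative_add])
    show "Ck_on k (\<lambda>x. frechet_derivative f (at x) v + frechet_derivative g (at x) v) U" for v
      using Suc.prems by (intro Suc.IH) auto
  qed (rule Ck_on_has_derivative[OF Suc.prems(1)], assumption,
      rule Ck_on_has_derivative[OF Suc.prems(2)], assumption)
qed

lemma Ck_on_sum:
  assumes "open U" "\<And>i. i \<in> I \<Longrightarrow> Ck_on k (f i) U"
  shows "Ck_on k (\<lambda>x. \<Sum>i\<in>I. f i x) U"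
  using assms(2)
  by (induction I rule: infinite_finite_induct) (auto intro: Ck_on_add Ck_on_const assms(1))

text \<open>Covers scalar multiplication, products and inner products at once. The product rule
  leaves one factor undifferentiated, which is why the induction also uses
  \<open>Ck_on_SucD\<close>.\<close>

lemma Ck_on_bilinear:
  assumes "open U" "bounded_bilinear B"
  shows "Ck_on k f U \<Longrightarrow> Ck_on k g U \<Longrightarrow> Ck_on k (\<lambda>x. B (f x) (g x)) U"
proof (induction k arbitrary: f g)
  case 0
  then show ?case using assms by (simp add: bounded_bilinear.continuous_on)
next
  case (Suc k)
  note fg = Suc.prems[THEN Ck_on_SucD]
  show ?case
  proof (rule Ck_on_SucI[OF assms(1) bounded_bilinear.FDERIV[OF assms(2)]])
    fix v
    show "Ck_on k (\<lambda>x. B (f x) (frechet_derivative g (at x) v) +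
        B (frechet_derivative f (at x) v) (g x)) U"
      using Suc.prems fg by (intro Ck_on_add Suc.IH assms(1)) auto
  qed (rule Ck_on_has_derivative[OF Suc.prems(1)], assumption,
      rule Ck_on_has_derivative[OF Suc.prems(2)], assumption)
qed

lemma smooth_on_const: "open U \<Longrightarrow> smooth_on (\<lambda>x. c) U"
  by (simp add: smooth_on_def Ck_on_const)

lemma smooth_on_add: "open U \<Longrightarrow> smooth_on f U \<Longrightarrow> smooth_on g U \<Longrightarrow> smooth_on (\<lambda>x. f x + g x) U"
  by (simp add: smooth_on_def Ck_on_add)

lemma smooth_on_sum:
  "open U \<Longrightarrow> (\<And>i. i \<in> I \<Longrightarrow> smooth_on (f i) U) \<Longrightarrow> smooth_on (\<lambda>x. \<Sum>i\<in>I. f i x) U"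
  by (simp add: smooth_on_def Ck_on_sum)

lemma smooth_on_bilinear:
  "open U \<Longrightarrow> bounded_bilinear B \<Longrightarrow> smooth_on f U \<Longrightarrow> smooth_on g U \<Longrightarrow> smooth_on (\<lambda>x. B (f x) (g x)) U"
  by (simp add: smooth_on_def Ck_on_bilinear)

lemmas smooth_on_scaleR = smooth_on_bilinear[OF _ bounded_bilinear_scaleR]
lemmas smooth_on_mult = smooth_on_bilinear[OF _ bounded_bilinear_mult]
lemmas smooth_on_inner = smooth_on_bilinear[OF _ bounded_bilinear_inner]

lemma smooth_on_has_derivative:
  "smooth_on f U \<Longrightarrow> x \<in> U \<Longrightarrow> (f has_derivative frechet_derivative f (at x)) (at x)"
  unfolding smooth_on_def by (rule Ck_on_has_derivative[of 0]) auto

lemma smooth_on_frechet_derivative: "smooth_on f U \<Longrightarrow> smooth_on (\<lambda>x. frechet_derivative f (at x) v) U"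
  unfolding smooth_on_def by (metis Ck_on.simps(2))

lemma smooth_on_cong:
  "open U \<Longrightarrow> (\<And>x. x \<in> U \<Longrightarrow> f x = g x) \<Longrightarrow> smooth_on f U \<longleftrightarrow> smooth_on g U"
  unfolding smooth_on_def using Ck_on_cong[of U f g] by auto

lemma linear_euclidean_expansion:
  fixes f :: "'a::euclidean_space \<Rightarrow> 'b::real_vector"
  assumes "linear f"
  shows "f v = (\<Sum>b\<in>Basis. (v \<bullet> b) *\<^sub>R f b)"
proof -
  have "f v = f (\<Sum>b\<in>Basis. (v \<bullet> b) *\<^sub>R b)" by (simp add: euclidean_representation)
  then show ?thesis by (simp add: linear_sum[OF assms] linear_cmul[OF assms])
qed

text \<open>\<open>Ck_on\<close> controls derivatives in fixed directions only; expanding the moving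
  direction \<open>X p\<close> in the basis reduces to those.\<close>

lemma smooth_on_dir_deriv:
  assumes U: "open U" and X: "smooth_on X U" and f: "smooth_on f U"
  shows "smooth_on (dir_deriv X (f :: 'a::euclidean_space \<Rightarrow> 'b::real_normed_vector)) U"
proof (subst smooth_on_cong[OF U])
  fix p assume "p \<in> U"
  with f have "linear (frechet_derivative f (at p))"
    by (blast intro: smooth_on_has_derivative has_derivative_linear)
  then show "dir_deriv X f p = (\<Sum>b\<in>Basis. (X p \<bullet> b) *\<^sub>R frechet_derivative f (at p) b)"
    unfolding dir_deriv_def by (rule linear_euclidean_expansion)
next
  show "smooth_on (\<lambda>p. \<Sum>b\<in>Basis. (X p \<bullet> b) *\<^sub>R frechet_derivative f (at p) b) U"
    by (intro smooth_on_sum smooth_on_scaleR smooth_on_inner smooth_on_const smooth_on_frechet_derivative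
        U X f)
qed

section \<open>Termwise differentiation\<close>

definition pderiv_coeff :: "'a \<Rightarrow> (('a \<Rightarrow> nat) \<Rightarrow> real) \<Rightarrow> ('a \<Rightarrow> nat) \<Rightarrow> real" where
  "pderiv_coeff k c \<alpha> = real (\<alpha> k + 1) * c (\<alpha> + unit_index k)"

text \<open>Reflects that \<open>t ^ Suc n - s ^ Suc n\<close> is \<open>t - s\<close> times a sum
  of \<open>n + 1\<close> products, each at least \<open>s ^ n\<close>. It absorbs the integer
  factor produced by differentiation into a slightly larger radius.\<close>

lemma Suc_power_le:
  fixes s t :: real
  assumes "0 \<le> s" "s \<le> t"
  shows "real (n + 1) * s ^ n * (t - s) \<le> t ^ Suc n"
proof (induction n)
  case (Suc n)
  have "real (Suc n + 1) * s ^ Suc n * (t - s) = s * (real (n + 1) * s ^ n * (t - s)) + s ^ Suc n * (t - s)"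
    by (simp add: algebra_simps)
  also have "\<dots> \<le> s * t ^ Suc n + t ^ Suc n * (t - s)"
    using assms by (intro add_mono mult_left_mono mult_right_mono Suc power_mono) auto
  finally show ?case by (simp add: algebra_simps)
qed (use assms in simp)

lemma converges_pderiv_coeff:
  assumes c: "converges c r" and k: "k \<in> Basis"
  shows "converges (pderiv_coeff k c) r"
  unfolding converges_def
proof (intro allI impI)
  fix s assume s: "0 \<le> s \<and> s < r"
  \<comment> \<open>Any radius strictly between \<open>s\<close> and \<open>r\<close> works:
    \<open>t < r\<close> gives summability, and \<open>s < t\<close> the positive gap to divide
    by.\<close>
  define t where "t = (s + r) / 2"
  have t: "0 \<le> t" "t < r" "s < t" using s by (auto simp: t_def)
  have "(\<lambda>\<alpha>. \<bar>c \<alpha>\<bar> * t ^ deg \<alpha>) summable_on multi_indices"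
    using c t by (simp add: converges_def)
  then have "(\<lambda>\<alpha>. \<bar>c \<alpha>\<bar> * t ^ deg \<alpha>) summable_on (\<lambda>\<gamma>. \<gamma> + unit_index k) ` multi_indices"
    by (rule summable_on_subset_banach) (use k in auto)
  then have "(\<lambda>\<gamma>. \<bar>c (\<gamma> + unit_index k)\<bar> * t ^ Suc (deg \<gamma>)) summable_on multi_indices"
    using k by (subst (asm) summable_on_reindex) (auto simp: inj_on_def o_def)
  then have "(\<lambda>\<gamma>. 1 / (t - s) * (\<bar>c (\<gamma> + unit_index k)\<bar> * t ^ Suc (deg \<gamma>))) summable_on multi_indices"
    by (rule summable_on_cmult_right)
  then show "(\<lambda>\<gamma>. \<bar>pderiv_coeff k c \<gamma>\<bar> * s ^ deg \<gamma>) summable_on multi_indices"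
  proof (rule summable_on_comparison_test)
    fix \<gamma> :: "'a \<Rightarrow> nat"
    have "real (\<gamma> k + 1) * s ^ deg \<gamma> * (t - s) \<le> real (deg \<gamma> + 1) * s ^ deg \<gamma> * (t - s)"
      using s t index_le_deg[OF k, of \<gamma>] by (intro mult_right_mono) auto
    also have "\<dots> \<le> t ^ Suc (deg \<gamma>)"
      using s t by (intro Suc_power_le) auto
    finally have "real (\<gamma> k + 1) * s ^ deg \<gamma> \<le> 1 / (t - s) * t ^ Suc (deg \<gamma>)"
      using t by (simp add: field_simps)
    from mult_left_mono[OF this, of "\<bar>c (\<gamma> + unit_index k)\<bar>"]
    show "\<bar>pderiv_coeff k c \<gamma>\<bar> * s ^ deg \<gamma> \<le> 1 / (t - s) * (\<bar>c (\<gamma> + unit_index k)\<bar> * t ^ Suc (deg \<gamma>))"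
      by (simp add: pderiv_coeff_def abs_mult ac_simps)
  qed (use s in auto)
qed

lemma recenter_zero: "recenter c p 0 = power_series c p"
  unfolding recenter_def power_series_def
  by (rule infsum_cong_neutral) (auto simp: index_binomial_def le_fun_def)

text \<open>The multi-index binomial of \<alpha> over \<open>unit_index k\<close> is
  \<open>\<alpha> k\<close>, so the degree-one Taylor coefficients at \<open>p\<close> are the
  termwise partial derivatives there.\<close>

lemma recenter_unit_index:
  assumes k: "k \<in> Basis"
  shows "recenter c p (unit_index k) = power_series (pderiv_coeff k c) p"
  unfolding recenter_def power_series_def
proof (rule infsum_reindex_bij_witness[where i = "\<lambda>\<gamma>. \<gamma> + unit_index k" and j = "\<lambda>\<alpha>. \<alpha> - unit_index k"])
  fix \<alpha> assume "\<alpha> \<in> {\<alpha> \<in> multi_indices. unit_index k \<le> \<alpha>}"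
  then have \<alpha>: "unit_index k \<le> \<alpha>" by simp
  have "index_binomial \<alpha> (unit_index k) = (\<Prod>b\<in>Basis. if b = k then real (\<alpha> k) else 1)"
    unfolding index_binomial_def unit_index_def by (intro prod.cong) auto
  also have "\<dots> = real (\<alpha> k)" using k by simp
  finally show "pderiv_coeff k c (\<alpha> - unit_index k) * mon p (\<alpha> - unit_index k) =
      c \<alpha> * index_binomial \<alpha> (unit_index k) * mon p (\<alpha> - unit_index k)"
    using \<alpha> by (auto simp: pderiv_coeff_def unit_index_le_iff)
qed (use k in \<open>auto simp: le_fun_def\<close>)

text \<open>After recentring at \<open>p\<close>, the terms of degree 0 and 1 are the value and the
  candidate derivative. In every other term the ratio \<open>norm y / \<rho>\<close>, at most 1,
  occurs at least squared, which bounds the remainder by a constant times the square of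
  \<open>norm y\<close>.\<close>

lemma power_series_has_derivative:
  fixes c :: "('a::euclidean_space \<Rightarrow> nat) \<Rightarrow> real"
  assumes c: "converges c r" and p: "p \<in> polydisc r"
  shows "(power_series c has_derivative (\<lambda>v. \<Sum>k\<in>Basis. (v \<bullet> k) * power_series (pderiv_coeff k c) p)) (at p)"
proof -
  obtain s where s: "0 \<le> s" "s < r" "\<And>b. b \<in> Basis \<Longrightarrow> \<bar>p \<bullet> b\<bar> \<le> s"
    using polydisc_bound[OF p] by blast
  define \<rho> where "\<rho> = (r - s) / 2"
  have \<rho>: "0 < \<rho>" "s + \<rho> < r" "\<And>b. b \<in> Basis \<Longrightarrow> \<bar>p \<bullet> b\<bar> + \<rho> \<le> s + \<rho>"
    using s by (auto simp: \<rho>_def field_simps)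
  let ?d = "recenter c p" and ?L = "\<lambda>v. \<Sum>k\<in>Basis. (v \<bullet> k) * power_series (pderiv_coeff k c) p"
  define K where "K = (\<Sum>\<^sub>\<infinity>\<beta>\<in>multi_indices. \<bar>?d \<beta>\<bar> * \<rho> ^ deg \<beta>)"
  have K: "((\<lambda>\<beta>. \<bar>?d \<beta>\<bar> * \<rho> ^ deg \<beta>) has_sum K) multi_indices"
    unfolding K_def using recenter_summable[OF c \<rho>(2,3)] \<rho>(1) by (intro has_sum_infsum) auto
  \<comment> \<open>The indices of the affine part of the Taylor expansion.\<close>
  define F where "F = insert 0 (unit_index ` (Basis :: 'a set))"
  have F: "finite F" "F \<subseteq> multi_indices" by (auto simp: F_def)
  have deg_ge_2: "2 \<le> deg \<beta>" if "\<beta> \<in> multi_indices - F" for \<beta>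
  proof -
    from that have "deg \<beta> \<noteq> 0" "deg \<beta> \<noteq> 1"
      using deg_eq_1[of \<beta>] deg_eq_0_iff[of \<beta>] by (auto simp: F_def)
    then show ?thesis by linarith
  qed
  have bound: "\<bar>power_series c (p + y) - power_series c p - ?L y\<bar> \<le> (norm y / \<rho>)\<^sup>2 * K"
    if y: "norm y \<le> \<rho>" for y
  proof -
    have y_le: "b \<in> Basis \<Longrightarrow> \<bar>y \<bullet> b\<bar> \<le> \<rho>" for b using y Basis_le_norm order_trans by blast
    have inj: "inj_on unit_index (Basis :: 'a set)"
      unfolding inj_on_def unit_index_def fun_eq_iff by (metis zero_neq_one)
    have "0 \<notin> unit_index ` (Basis :: 'a set)"
      by (auto simp: unit_index_def fun_eq_iff) (metis zero_neq_one)
    then have "(\<Sum>\<beta>\<in>F. ?d \<beta> * mon y \<beta>) = power_series c p + ?L y"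
      by (simp add: F_def recenter_zero sum.reindex[OF inj] recenter_unit_index mult.commute)
    then have "((\<lambda>\<beta>. ?d \<beta> * mon y \<beta>) has_sum (power_series c p + ?L y)) F"
      using F by (simp add: has_sum_finiteI)
    from has_sum_Diff[OF recenter_has_sum[OF c \<rho>(2,3) y_le] this F(2)]
    have sum: "((\<lambda>\<beta>. ?d \<beta> * mon y \<beta>) has_sum (power_series c (p + y) - power_series c p - ?L y))
        (multi_indices - F)"
      by (simp add: diff_diff_eq)
    have term_le: "\<bar>?d \<beta> * mon y \<beta>\<bar> \<le> (norm y / \<rho>)\<^sup>2 * (\<bar>?d \<beta>\<bar> * \<rho> ^ deg \<beta>)"
      if \<beta>: "\<beta> \<in> multi_indices - F" for \<beta>
    proof -
      have "\<bar>mon y \<beta>\<bar> \<le> norm y ^ deg \<beta>"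
        by (rule mon_le_power_deg) (rule Basis_le_norm)
      also have "\<dots> = (norm y / \<rho>) ^ deg \<beta> * \<rho> ^ deg \<beta>"
        using \<rho>(1) by (simp add: power_divide)
      also have "\<dots> \<le> (norm y / \<rho>)\<^sup>2 * \<rho> ^ deg \<beta>"
        using \<rho>(1) y deg_ge_2[OF \<beta>] by (intro mult_right_mono power_decreasing) auto
      finally have "\<bar>?d \<beta>\<bar> * \<bar>mon y \<beta>\<bar> \<le> \<bar>?d \<beta>\<bar> * ((norm y / \<rho>)\<^sup>2 * \<rho> ^ deg \<beta>)"
        by (intro mult_left_mono) auto
      then show ?thesis by (simp add: abs_mult ac_simps)
    qed
    note Ky = has_sum_cmult_right[OF K, of "(norm y / \<rho>)\<^sup>2"]
    have nonneg: "0 \<le> (norm y / \<rho>)\<^sup>2 * (\<bar>?d \<beta>\<bar> * \<rho> ^ deg \<beta>)" for \<beta>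
      using \<rho>(1) by simp
    \<comment> \<open>\<open>K\<close> sums over all multi-indices while the remainder omits
      \<open>F\<close>; the surplus terms are nonnegative.\<close>
    have "power_series c (p + y) - power_series c p - ?L y \<le> (norm y / \<rho>)\<^sup>2 * K"
      by (rule has_sum_mono_neutral[OF sum Ky]) (use term_le nonneg in \<open>auto dest: abs_le_D1\<close>)
    moreover have "- (power_series c (p + y) - power_series c p - ?L y) \<le> (norm y / \<rho>)\<^sup>2 * K"
      by (rule has_sum_mono_neutral[OF has_sum_uminusI[OF sum] Ky])
        (use term_le nonneg in \<open>auto dest: abs_le_D2\<close>)
    ultimately show ?thesis by (simp add: abs_le_iff)
  qed
  show ?thesis
  proof (rule has_derivativeI_sandwich[OF \<rho>(1)])
    show "bounded_linear ?L"
      by (intro bounded_linear_sum bounded_linear_mult_const bounded_linear_inner_left)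
    show "norm (power_series c x - power_series c p - ?L (x - p)) / norm (x - p)
        \<le> norm (x - p) * (K / \<rho>\<^sup>2)" if "x \<noteq> p" "dist x p < \<rho>" for x
    proof -
      have "norm (power_series c x - power_series c p - ?L (x - p)) \<le> (norm (x - p) / \<rho>)\<^sup>2 * K"
        using bound[of "x - p"] that by (simp add: dist_norm)
      also have "\<dots> = norm (x - p) * (K / \<rho>\<^sup>2) * norm (x - p)"
        by (simp add: power2_eq_square)
      finally show ?thesis using that by (simp add: pos_divide_le_eq)
    qed
    have "((\<lambda>x. norm (x - p) * (K / \<rho>\<^sup>2)) \<longlongrightarrow> norm (p - p) * (K / \<rho>\<^sup>2)) (at p)"
      by (intro tendsto_intros)
    then show "((\<lambda>x. norm (x - p) * (K / \<rho>\<^sup>2)) \<longlongrightarrow> 0) (at p)" by simp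
  qed
qed

lemma Ck_on_power_series: "converges c r \<Longrightarrow> Ck_on k (power_series c) (polydisc r)"
proof (induction k arbitrary: c)
  case 0
  then show ?case
    by (auto intro!: continuous_at_imp_continuous_on has_derivative_continuous power_series_has_derivative)
next
  case (Suc k)
  show ?case
  proof (rule Ck_on_SucI[OF open_polydisc])
    show "(power_series c has_derivative (\<lambda>v. \<Sum>k\<in>Basis. (v \<bullet> k) * power_series (pderiv_coeff k c) p)) (at p)"
      if "p \<in> polydisc r" for p
      using Suc.prems that by (rule power_series_has_derivative)
    show "Ck_on k (\<lambda>p. \<Sum>k\<in>Basis. (v \<bullet> k) * power_series (pderiv_coeff k c) p) (polydisc r)" for v
      by (intro Ck_on_sum Ck_on_bounded_linear[OF _ bounded_linear_mult_right] open_polydisc Suc.IH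
          converges_pderiv_coeff Suc.prems)
  qed
qed

lemma smooth_on_power_series: "converges c r \<Longrightarrow> smooth_on (power_series c) (polydisc r)"
  by (simp add: smooth_on_def Ck_on_power_series)

text \<open>Analyticity asks for an expansion around every point; \<open>recenter\<close> provides
  it, on a ball contained in the polydisc of radius \<rho> around \<open>p\<close>.\<close>

lemma real_analytic_on_power_series:
  fixes c :: "('a::euclidean_space \<Rightarrow> nat) \<Rightarrow> real"
  assumes c: "converges c r"
  shows "real_analytic_on (power_series c) (polydisc r)"
  unfolding real_analytic_on_def multi_indices_def[symmetric] mon_def[symmetric]
proof
  fix p :: 'a assume "p \<in> polydisc r"
  then obtain s where s: "s < r" "\<And>b. b \<in> Basis \<Longrightarrow> \<bar>p \<bullet> b\<bar> \<le> s"
    using polydisc_bound by blast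
  define \<rho> where "\<rho> = (r - s) / 2"
  have \<rho>: "0 < \<rho>" "s + \<rho> < r" "\<And>b. b \<in> Basis \<Longrightarrow> \<bar>p \<bullet> b\<bar> + \<rho> \<le> s + \<rho>"
    using s by (auto simp: \<rho>_def field_simps)
  have "((\<lambda>\<alpha>. recenter c p \<alpha> * mon (x - p) \<alpha>) has_sum power_series c x) multi_indices"
    if "x \<in> ball p \<rho>" for x
  proof -
    have "norm (x - p) \<le> \<rho>" using that by (simp add: dist_norm norm_minus_commute)
    then have "b \<in> Basis \<Longrightarrow> \<bar>(x - p) \<bullet> b\<bar> \<le> \<rho>" for b
      using Basis_le_norm order_trans by blast
    from recenter_has_sum[OF c \<rho>(2,3) this] show ?thesis by simp
  qed
  with \<rho>(1) show "\<exists>d. \<exists>\<rho>>0. \<forall>x\<in>ball p \<rho>.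
      ((\<lambda>\<alpha>. d \<alpha> * mon (x - p) \<alpha>) has_sum power_series c x) multi_indices"
    by blast
qed

section \<open>The recursion for the Christoffel symbols\<close>

text \<open>Meaningful only in dimension at least three (\<open>SOME\<close> over a possibly empty set); it depends only
  on \<open>{i, j}\<close>, which makes the symbols symmetric.\<close>

definition third :: "'a::euclidean_space \<Rightarrow> 'a \<Rightarrow> 'a" where
  "third i j = (SOME k. k \<in> Basis - {i, j})"

lemma third_commute: "third i j = third j i"
  by (simp add: third_def insert_commute)

text \<open>The dimension hypothesis enters the construction here.\<close>

lemma third_in:
  assumes "DIM('a::euclidean_space) \<ge> 3"
  shows "third i (j :: 'a) \<in> Basis - {i, j}"
proof -
  have "card {i, j} < DIM('a)" using assms card_insert_le_m1[of 2 "{j}" i] by simp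
  then have "\<not> Basis \<subseteq> {i, j}" using card_mono[of "{i, j}" Basis] by auto
  then have "\<exists>k. k \<in> Basis - {i, j}" by auto
  then show ?thesis unfolding third_def by (rule someI_ex)
qed

text \<open>The coefficient form of
  \<open>\<Gamma>\<^sub>i\<^sub>j\<^sup>k = B\<^sub>i\<^sub>j\<^sup>k + \<integral> (\<Sum>\<^sub>a\<^sub>b \<Gamma>\<^sub>i\<^sub>a\<^sup>b \<Gamma>\<^sub>j\<^sub>b\<^sup>a) dx\<^sub>k\<close> for \<open>k = third i j\<close>; the upper index comes last in
  \<open>gamma_coeff B i j k\<close>.\<close>

function gamma_coeff ::
    "('a::euclidean_space \<Rightarrow> 'a \<Rightarrow> 'a \<Rightarrow> ('a \<Rightarrow> nat) \<Rightarrow> real) \<Rightarrow> 'a \<Rightarrow> 'a \<Rightarrow> 'a \<Rightarrow> ('a \<Rightarrow> nat) \<Rightarrow> real" where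
  "gamma_coeff B i j k \<alpha> = B i j k \<alpha> +
     (if k = third i j \<and> k \<in> Basis \<and> 0 < \<alpha> k
      then (\<Sum>a\<in>Basis. \<Sum>b\<in>Basis. \<Sum>\<beta>\<in>{..\<alpha> - unit_index k}.
              gamma_coeff B i a b \<beta> * gamma_coeff B j b a (\<alpha> - unit_index k - \<beta>)) / real (\<alpha> k)
      else 0)"
  by auto
termination
\<comment> \<open>Both factors of the product have index at most
  \<open>\<alpha> - unit_index k\<close>. The guards \<open>k \<in> Basis\<close> and
  \<open>0 < \<alpha> k\<close> ensure that this index has smaller degree, since \<open>deg\<close>
  counts basis entries only.\<close>
proof (relation "Wellfounded.measure (\<lambda>(B, i, j, k, \<alpha>). deg \<alpha>)", goal_cases)
  case (2 B i j k \<alpha> a b \<beta>)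
  then have "deg \<beta> \<le> deg (\<alpha> - unit_index k)" "Suc (deg (\<alpha> - unit_index k)) = deg \<alpha>"
    by (auto intro: deg_mono deg_diff_unit_index)
  then show ?case by simp
next
  case (3 B i j k \<alpha> a b \<beta>)
  then have "Suc (deg (\<alpha> - unit_index k)) = deg \<alpha>"
    by (auto intro: deg_diff_unit_index)
  moreover have "deg (\<alpha> - unit_index k - \<beta>) \<le> deg (\<alpha> - unit_index k)"
    by (rule deg_mono[OF index_diff_le])
  ultimately show ?case by simp
qed simp

declare gamma_coeff.simps [simp del]

lemma gamma_coeff_eq:
  "gamma_coeff B i j k \<alpha> = B i j k \<alpha> +
     (if k = third i j \<and> k \<in> Basis \<and> 0 < \<alpha> k
      then (\<Sum>a\<in>Basis. \<Sum>b\<in>Basis.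
              index_convolution (gamma_coeff B i a b) (gamma_coeff B j b a) (\<alpha> - unit_index k)) / real (\<alpha> k)
      else 0)"
  unfolding index_convolution_def by (rule gamma_coeff.simps)

text \<open>The quadratic term is a trace of a product, hence symmetric in \<open>i, j\<close> after
  exchanging \<open>a\<close> and \<open>b\<close>; with the symmetry of \<open>third\<close> this
  yields torsion freeness.\<close>

lemma gamma_coeff_commute:
  assumes "\<And>\<alpha>. B i j k \<alpha> = B j i k \<alpha>"
  shows "gamma_coeff B i j k = gamma_coeff B j i k"
proof
  fix \<alpha>
  have "(\<Sum>a\<in>Basis. \<Sum>b\<in>Basis. index_convolution (gamma_coeff B i a b) (gamma_coeff B j b a) \<gamma>) =
        (\<Sum>a\<in>Basis. \<Sum>b\<in>Basis. index_convolution (gamma_coeff B j a b) (gamma_coeff B i b a) \<gamma>)" for \<gamma>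
    by (subst sum.swap) (simp add: index_convolution_commute)
  then show "gamma_coeff B i j k \<alpha> = gamma_coeff B j i k \<alpha>"
    by (simp only: gamma_coeff_eq[of B i j k \<alpha>] gamma_coeff_eq[of B j i k \<alpha>] assms third_commute[of j i])
qed

text \<open>Differentiating in \<open>k\<close> undoes the integration: the factor
  \<open>\<alpha> k + 1\<close> cancels the division in the recursion.\<close>

lemma pderiv_gamma_coeff:
  assumes "k \<in> Basis"
  shows "pderiv_coeff k (gamma_coeff B i j k) \<alpha> = pderiv_coeff k (B i j k) \<alpha> +
     (if k = third i j
      then \<Sum>a\<in>Basis. \<Sum>b\<in>Basis. index_convolution (gamma_coeff B i a b) (gamma_coeff B j b a) \<alpha> else 0)"
proof -
  have "\<alpha> + unit_index k - unit_index k = \<alpha>" "(\<alpha> + unit_index k) k = \<alpha> k + 1"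
    by (auto simp: fun_eq_iff unit_index_def)
  then show ?thesis
    using assms by (simp add: pderiv_coeff_def gamma_coeff_eq[of B i j k] distrib_left)
qed

section \<open>Majorants and convergence of the recursion\<close>

definition deg_le :: "nat \<Rightarrow> ('a::euclidean_space \<Rightarrow> nat) set" where
  "deg_le n = {\<alpha> \<in> multi_indices. deg \<alpha> \<le> n}"

text \<open>A weighted sum norm truncated at degree \<open>n\<close>. The truncation keeps it finite
  before convergence is known and permits induction on \<open>n\<close>.\<close>

definition majorant :: "real \<Rightarrow> nat \<Rightarrow> (('a::euclidean_space \<Rightarrow> nat) \<Rightarrow> real) \<Rightarrow> real" where
  "majorant r n c = (\<Sum>\<alpha>\<in>deg_le n. \<bar>c \<alpha>\<bar> * r ^ deg \<alpha>)"

lemma finite_deg_le_set [simp]: "finite (deg_le n)"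
  by (simp add: deg_le_def finite_deg_le)

lemma majorant_nonneg: "0 \<le> r \<Longrightarrow> 0 \<le> majorant r n c"
  by (simp add: majorant_def sum_nonneg)

text \<open>The pairs \<open>(\<beta>, \<alpha> - \<beta>)\<close> with
  \<open>deg \<alpha> \<le> n\<close> are distinct and lie in
  \<open>deg_le n \<times> deg_le n\<close>; the remaining pairs of that square contribute
  nonnegative terms.\<close>

lemma majorant_convolution:
  fixes c d :: "('a::euclidean_space \<Rightarrow> nat) \<Rightarrow> real"
  assumes r: "0 \<le> r"
  shows "majorant r n (index_convolution c d) \<le> majorant r n c * majorant r n d"
proof -
  let ?f = "\<lambda>\<beta>. \<bar>c \<beta>\<bar> * r ^ deg \<beta>" and ?g = "\<lambda>\<beta>. \<bar>d \<beta>\<bar> * r ^ deg \<beta>"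
  have "majorant r n (index_convolution c d) \<le> (\<Sum>\<alpha>\<in>deg_le n. \<Sum>\<beta>\<in>{..\<alpha>}. ?f \<beta> * ?g (\<alpha> - \<beta>))"
    unfolding majorant_def
  proof (rule sum_mono)
    fix \<alpha> :: "'a \<Rightarrow> nat"
    have "\<bar>index_convolution c d \<alpha>\<bar> * r ^ deg \<alpha> \<le> (\<Sum>\<beta>\<in>{..\<alpha>}. \<bar>c \<beta> * d (\<alpha> - \<beta>)\<bar>) * r ^ deg \<alpha>"
      unfolding index_convolution_def by (intro mult_right_mono sum_abs zero_le_power r)
    also have "\<dots> = (\<Sum>\<beta>\<in>{..\<alpha>}. ?f \<beta> * ?g (\<alpha> - \<beta>))"
      unfolding sum_distrib_right
    proof (rule sum.cong)
      fix \<beta> assume "\<beta> \<in> {..\<alpha>}"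
      then have "deg \<alpha> = deg \<beta> + deg (\<alpha> - \<beta>)" by (simp flip: deg_add)
      then show "\<bar>c \<beta> * d (\<alpha> - \<beta>)\<bar> * r ^ deg \<alpha> = ?f \<beta> * ?g (\<alpha> - \<beta>)"
        by (simp add: abs_mult power_add)
    qed simp
    finally show "\<bar>index_convolution c d \<alpha>\<bar> * r ^ deg \<alpha> \<le> \<dots>" .
  qed
  also have "\<dots> = (\<Sum>(\<alpha>, \<beta>)\<in>Sigma (deg_le n) atMost. ?f \<beta> * ?g (\<alpha> - \<beta>))"
    by (rule sum.Sigma) (auto simp: deg_le_def finite_index_atMost finite_deg_le)
  also have "\<dots> = (\<Sum>(\<beta>, \<gamma>)\<in>(\<lambda>(\<alpha>, \<beta>). (\<beta>, \<alpha> - \<beta>)) ` Sigma (deg_le n) atMost. ?f \<beta> * ?g \<gamma>)"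
    by (subst sum.reindex) (auto simp: inj_on_def case_prod_unfold, metis index_add_diff(1))
  also have "\<dots> \<le> (\<Sum>(\<beta>, \<gamma>)\<in>deg_le n \<times> deg_le n. ?f \<beta> * ?g \<gamma>)"
  proof (rule sum_mono2)
    show "(\<lambda>(\<alpha>, \<beta>). (\<beta>, \<alpha> - \<beta>)) ` Sigma (deg_le n) atMost \<subseteq> deg_le n \<times> (deg_le n :: ('a \<Rightarrow> nat) set)"
    proof clarify
      fix \<alpha> \<beta> :: "'a \<Rightarrow> nat" assume "\<alpha> \<in> deg_le n" "\<beta> \<le> \<alpha>"
      moreover note index_diff_le[of \<alpha> \<beta>]
      ultimately show "\<beta> \<in> deg_le n \<and> \<alpha> - \<beta> \<in> deg_le n"
        by (auto simp: deg_le_def intro: multi_indices_downward order_trans[OF deg_mono])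
    qed
  qed (use r in auto)
  also have "\<dots> = majorant r n c * majorant r n d"
    by (simp add: majorant_def sum_product sum.cartesian_product)
  finally show ?thesis .
qed

text \<open>Models multiplication by the \<open>k\<close>-th coordinate. The gain of one degree
  drives the induction, and the factor \<open>r\<close> makes the estimate small.\<close>

lemma majorant_shift:
  fixes c :: "('a::euclidean_space \<Rightarrow> nat) \<Rightarrow> real"
  assumes "k \<in> Basis"
  shows "majorant r (Suc n) (\<lambda>\<alpha>. if 0 < \<alpha> k then c (\<alpha> - unit_index k) else 0) = r * majorant r n c"
proof -
  have "majorant r (Suc n) (\<lambda>\<alpha>. if 0 < \<alpha> k then c (\<alpha> - unit_index k) else 0) =
      (\<Sum>\<alpha>\<in>{\<alpha>\<in>deg_le (Suc n). 0 < \<alpha> k}. \<bar>c (\<alpha> - unit_index k)\<bar> * r ^ deg \<alpha>)"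
    unfolding majorant_def by (rule sum.mono_neutral_cong_right) auto
  also have "\<dots> = (\<Sum>\<gamma>\<in>deg_le n. r * (\<bar>c \<gamma>\<bar> * r ^ deg \<gamma>))"
  proof (rule sum.reindex_bij_witness[where i = "\<lambda>\<gamma>. \<gamma> + unit_index k" and j = "\<lambda>\<alpha>. \<alpha> - unit_index k"])
    fix \<alpha> assume "\<alpha> \<in> {\<alpha> \<in> deg_le (Suc n). 0 < \<alpha> k}"
    then have \<alpha>: "\<alpha> \<in> multi_indices" "deg \<alpha> \<le> Suc n" "unit_index k \<le> \<alpha>"
        "Suc (deg (\<alpha> - unit_index k)) = deg \<alpha>"
      using assms by (auto simp: deg_le_def unit_index_le_iff deg_diff_unit_index)
    then show "\<alpha> - unit_index k + unit_index k = \<alpha>" "\<alpha> - unit_index k \<in> deg_le n"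
      by (auto simp: deg_le_def)
    show "r * (\<bar>c (\<alpha> - unit_index k)\<bar> * r ^ deg (\<alpha> - unit_index k)) =
        \<bar>c (\<alpha> - unit_index k)\<bar> * r ^ deg \<alpha>"
      by (simp flip: \<alpha>(4))
  qed (use assms in \<open>auto simp: deg_le_def\<close>)
  finally show ?thesis by (simp add: majorant_def sum_distrib_left)
qed

lemma majorant_mono:
  assumes "0 \<le> r" "\<And>\<alpha>. \<bar>c \<alpha>\<bar> \<le> d \<alpha>"
  shows "majorant r n c \<le> majorant r n d"
  unfolding majorant_def
  by (intro sum_mono mult_right_mono order_trans[OF assms(2)]) (use assms in auto)

lemma majorant_add:
  assumes "0 \<le> r"
  shows "majorant r n (\<lambda>\<alpha>. c \<alpha> + d \<alpha>) \<le> majorant r n c + majorant r n d"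
  unfolding majorant_def sum.distrib[symmetric]
  by (intro sum_mono) (use assms in \<open>auto simp flip: distrib_right intro!: mult_right_mono abs_triangle_ineq\<close>)

lemma majorant_sum:
  assumes "0 \<le> r"
  shows "majorant r n (\<lambda>\<alpha>. \<Sum>i\<in>I. c i \<alpha>) \<le> (\<Sum>i\<in>I. majorant r n (c i))"
proof (induction I rule: infinite_finite_induct)
  case (insert x F)
  then show ?case using majorant_add[OF assms, of n "c x" "\<lambda>\<alpha>. \<Sum>i\<in>F. c i \<alpha>"] by simp
qed (simp_all add: majorant_def)

text \<open>Only degree one contributes, so the bound is uniform in \<open>n\<close> and linear in
  \<open>r\<close>; \<open>majorant 1 1 c\<close> is the sum of the absolute values of the linear
  coefficients.\<close>

lemma majorant_linear:
  fixes c :: "('a::euclidean_space \<Rightarrow> nat) \<Rightarrow> real"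
  assumes "0 \<le> r" "\<And>\<alpha>. \<alpha> \<in> multi_indices \<Longrightarrow> deg \<alpha> \<noteq> 1 \<Longrightarrow> c \<alpha> = 0"
  shows "majorant r n c \<le> r * majorant 1 1 c"
proof -
  have "majorant r n c = (\<Sum>\<alpha>\<in>{\<alpha>\<in>deg_le n. deg \<alpha> = 1}. r * \<bar>c \<alpha>\<bar>)"
    unfolding majorant_def by (rule sum.mono_neutral_cong_right) (use assms in \<open>auto simp: deg_le_def finite_deg_le\<close>)
  also have "\<dots> \<le> (\<Sum>\<alpha>\<in>deg_le 1. r * \<bar>c \<alpha>\<bar>)"
    by (rule sum_mono2) (use assms in \<open>auto simp: deg_le_def finite_deg_le\<close>)
  finally show ?thesis by (simp add: majorant_def sum_distrib_left)
qed

lemma converges_if_majorant_bounded: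
  assumes r: "0 \<le> r" and C: "\<And>n. majorant r n c \<le> C"
  shows "converges c r"
  unfolding converges_def
proof (intro allI impI nonneg_bdd_above_summable_on bdd_aboveI2)
  fix s and F :: "('a \<Rightarrow> nat) set"
  assume s: "0 \<le> s \<and> s < r" and "F \<in> {F. F \<subseteq> multi_indices \<and> finite F}"
  \<comment> \<open>The sum of all degrees in \<open>F\<close> is a crude bound for each of
    them.\<close>
  then have F: "F \<subseteq> deg_le (\<Sum>\<alpha>\<in>F. deg \<alpha>)" by (auto simp: deg_le_def intro: member_le_sum)
  have "(\<Sum>\<alpha>\<in>F. \<bar>c \<alpha>\<bar> * s ^ deg \<alpha>) \<le> (\<Sum>\<alpha>\<in>F. \<bar>c \<alpha>\<bar> * r ^ deg \<alpha>)"
    using s by (intro sum_mono mult_left_mono power_mono) auto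
  also have "\<dots> \<le> majorant r (\<Sum>\<alpha>\<in>F. deg \<alpha>) c"
    unfolding majorant_def using F r by (intro sum_mono2) auto
  also have "\<dots> \<le> C" by (rule C)
  finally show "(\<Sum>\<alpha>\<in>F. \<bar>c \<alpha>\<bar> * s ^ deg \<alpha>) \<le> C" .
qed auto

lemma majorant_gamma_coeff_Suc:
  assumes r: "0 \<le> r" and B: "\<And>\<alpha>. \<alpha> \<in> multi_indices \<Longrightarrow> deg \<alpha> \<noteq> 1 \<Longrightarrow> B i j k \<alpha> = 0"
  shows "majorant r (Suc n) (gamma_coeff B i j k) \<le> r * majorant 1 1 (B i j k) +
     (if k = third i j then r * (\<Sum>a\<in>Basis. \<Sum>b\<in>Basis.
        majorant r n (gamma_coeff B i a b) * majorant r n (gamma_coeff B j b a)) else 0)"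
proof -
  let ?C = "\<lambda>\<alpha>. \<Sum>a\<in>Basis. \<Sum>b\<in>Basis. index_convolution (gamma_coeff B i a b) (gamma_coeff B j b a) \<alpha>"
  let ?X = "\<Sum>a\<in>Basis. \<Sum>b\<in>Basis. majorant r n (gamma_coeff B i a b) * majorant r n (gamma_coeff B j b a)"
  define h where "h \<alpha> = (if k = third i j \<and> k \<in> Basis \<and> 0 < \<alpha> k
      then ?C (\<alpha> - unit_index k) / real (\<alpha> k) else 0)" for \<alpha>
  have "gamma_coeff B i j k = (\<lambda>\<alpha>. B i j k \<alpha> + h \<alpha>)"
    by (rule ext) (simp add: gamma_coeff_eq[of B i j k] h_def)
  then have "majorant r (Suc n) (gamma_coeff B i j k) \<le> majorant r (Suc n) (B i j k) + majorant r (Suc n) h"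
    using majorant_add[OF r] by simp
  moreover have "majorant r (Suc n) (B i j k) \<le> r * majorant 1 1 (B i j k)"
    by (rule majorant_linear[OF r B])
  moreover have "majorant r (Suc n) h \<le> (if k = third i j then r * ?X else 0)"
  proof (cases "k = third i j \<and> k \<in> Basis")
    case True
    have "majorant r n ?C \<le> (\<Sum>a\<in>Basis. \<Sum>b\<in>Basis.
        majorant r n (index_convolution (gamma_coeff B i a b) (gamma_coeff B j b a)))"
      by (rule order_trans[OF majorant_sum[OF r] sum_mono[OF majorant_sum[OF r]]])
    also have "\<dots> \<le> ?X" by (intro sum_mono majorant_convolution r)
    finally have C: "majorant r n ?C \<le> ?X" .
    \<comment> \<open>The divisor coming from the integration is a positive integer, so dropping it
      only enlarges the majorant and leaves a pure shift.\<close>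
    have "\<bar>x / real m\<bar> \<le> \<bar>x\<bar>" if "0 < m" for x :: real and m
      using that by (simp add: divide_le_eq mult_le_cancel_left1)
    then have "\<bar>h \<alpha>\<bar> \<le> \<bar>if 0 < \<alpha> k then ?C (\<alpha> - unit_index k) else 0\<bar>" for \<alpha>
      by (simp add: h_def)
    then have "majorant r (Suc n) h \<le> majorant r (Suc n) (\<lambda>\<alpha>. \<bar>if 0 < \<alpha> k then ?C (\<alpha> - unit_index k) else 0\<bar>)"
      by (rule majorant_mono[OF r])
    also have "\<dots> = majorant r (Suc n) (\<lambda>\<alpha>. if 0 < \<alpha> k then ?C (\<alpha> - unit_index k) else 0)"
      by (simp add: majorant_def)
    also have "\<dots> \<le> r * ?X"
      using majorant_shift[OF True[THEN conjunct2], of r n ?C] mult_left_mono[OF C r] by linarith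
    finally show ?thesis using True by simp
  next
    case False
    then have "h = (\<lambda>_. 0)" by (auto simp: h_def)
    then have "majorant r (Suc n) h = 0" by (simp add: majorant_def)
    then show ?thesis using r by (simp add: sum_nonneg majorant_nonneg)
  qed
  ultimately show ?thesis by linarith
qed

text \<open>With \<open>S\<^sub>n\<close> the sum below and \<open>M\<close> the total size of \<open>B\<close>, the recursion gives
  \<open>S\<^sub>n\<^sub>+\<^sub>1 \<le> r M + r S\<^sub>n\<^sup>2\<close>, so \<open>S\<^sub>n \<le> 1\<close> propagates once \<open>r (M + 1) \<le> 1\<close>.\<close>

lemma majorant_gamma_coeff_le:
  fixes B :: "'a::euclidean_space \<Rightarrow> 'a \<Rightarrow> 'a \<Rightarrow> ('a \<Rightarrow> nat) \<Rightarrow> real"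
  assumes r: "0 \<le> r" "r * ((\<Sum>i\<in>Basis. \<Sum>j\<in>Basis. \<Sum>k\<in>Basis. majorant 1 1 (B i j k)) + 1) \<le> 1"
    and B: "\<And>i j k \<alpha>. \<alpha> \<in> multi_indices \<Longrightarrow> deg \<alpha> \<noteq> 1 \<Longrightarrow> B i j k \<alpha> = 0"
  shows "(\<Sum>i\<in>Basis. \<Sum>j\<in>Basis. \<Sum>k\<in>Basis. majorant r n (gamma_coeff B i j k)) \<le> 1"
proof (induction n)
  case 0
  \<comment> \<open>All symbols vanish at the origin: \<open>B\<close> has no constant term and
    integration adds none.\<close>
  have "majorant r 0 (gamma_coeff B i j k) = 0" for i j k
  proof -
    have "deg_le 0 = {0 :: 'a \<Rightarrow> nat}" by (auto simp: deg_le_def deg_eq_0_iff)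
    moreover have "gamma_coeff B i j k 0 = 0" by (simp add: gamma_coeff_eq[of B i j k] B)
    ultimately show ?thesis by (simp add: majorant_def)
  qed
  then show ?case by simp
next
  case (Suc n)
  define P where "P i j k = majorant r n (gamma_coeff B i j k)" for i j k
  \<comment> \<open>Bounding the trace of the product by \<open>Q i * Q j\<close> decouples
    \<open>i\<close> from \<open>j\<close>, so that summing over both gives the square of the total
    sum.\<close>
  define Q where "Q i = (\<Sum>a\<in>Basis. \<Sum>b\<in>Basis. P i a b)" for i
  let ?M = "\<Sum>i\<in>Basis. \<Sum>j\<in>Basis. \<Sum>k\<in>Basis. majorant 1 1 (B i j k)"
  have P: "0 \<le> P i j k" for i j k by (simp add: P_def majorant_nonneg r)
  have Q: "0 \<le> Q i" for i by (simp add: Q_def P sum_nonneg)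
  have P_le_Q: "P j b a \<le> Q j" if "a \<in> Basis" "b \<in> Basis" for j a b
  proof -
    have "P j b a \<le> (\<Sum>a\<in>Basis. P j b a)" using that P by (intro member_le_sum) auto
    also have "\<dots> \<le> Q j" unfolding Q_def using that P
      by (intro member_le_sum[of b Basis "\<lambda>b. \<Sum>a\<in>Basis. P j b a"]) (auto intro: sum_nonneg)
    finally show ?thesis .
  qed
  have X: "(\<Sum>a\<in>Basis. \<Sum>b\<in>Basis. P i a b * P j b a) \<le> Q i * Q j" for i j
    unfolding Q_def[of i] sum_distrib_right by (intro sum_mono mult_left_mono P_le_Q P)
  have S: "0 \<le> (\<Sum>i\<in>Basis. Q i)" "(\<Sum>i\<in>Basis. Q i) \<le> 1"
    using Suc.IH by (simp_all add: Q P_def[symmetric] Q_def sum_nonneg P)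
  have "(\<Sum>i\<in>Basis. \<Sum>j\<in>Basis. \<Sum>k\<in>Basis. majorant r (Suc n) (gamma_coeff B i j k)) \<le>
      (\<Sum>i\<in>Basis. \<Sum>j\<in>Basis. \<Sum>k\<in>Basis. r * majorant 1 1 (B i j k) +
         (if k = third i j then r * (\<Sum>a\<in>Basis. \<Sum>b\<in>Basis. P i a b * P j b a) else 0))"
    unfolding P_def using r B by (intro sum_mono majorant_gamma_coeff_Suc)
  also have "\<dots> \<le> (\<Sum>i\<in>Basis. \<Sum>j\<in>Basis. (\<Sum>k\<in>Basis. r * majorant 1 1 (B i j k)) + r * (Q i * Q j))"
  proof (intro sum_mono)
    fix i j :: 'a
    \<comment> \<open>At most one basis vector equals \<open>third i j\<close>, so the quadratic
      bound is counted at most once per pair.\<close>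
    have "(\<Sum>k\<in>Basis. if k = third i j then r * (\<Sum>a\<in>Basis. \<Sum>b\<in>Basis. P i a b * P j b a) else 0) \<le> r * (Q i * Q j)"
      using r Q mult_left_mono[OF X r(1)] by simp
    then show "(\<Sum>k\<in>Basis. r * majorant 1 1 (B i j k) +
         (if k = third i j then r * (\<Sum>a\<in>Basis. \<Sum>b\<in>Basis. P i a b * P j b a) else 0)) \<le>
         (\<Sum>k\<in>Basis. r * majorant 1 1 (B i j k)) + r * (Q i * Q j)"
      by (simp add: sum.distrib)
  qed
  also have "\<dots> = r * ?M + r * ((\<Sum>i\<in>Basis. Q i) * (\<Sum>j\<in>Basis. Q j))"
    by (simp add: sum.distrib sum_product flip: sum_distrib_left)
  also have "\<dots> \<le> r * ?M + r * (1 * 1)"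
    using S r by (intro add_mono mult_left_mono mult_mono) auto
  also have "\<dots> \<le> 1" using r by (simp add: distrib_left)
  finally show ?case .
qed

lemma gamma_coeff_converges:
  fixes B :: "'a::euclidean_space \<Rightarrow> 'a \<Rightarrow> 'a \<Rightarrow> ('a \<Rightarrow> nat) \<Rightarrow> real"
  assumes B: "\<And>i j k \<alpha>. \<alpha> \<in> multi_indices \<Longrightarrow> deg \<alpha> \<noteq> 1 \<Longrightarrow> B i j k \<alpha> = 0"
  shows "\<exists>r>0. \<forall>i\<in>Basis. \<forall>j\<in>Basis. \<forall>k\<in>Basis. converges (gamma_coeff B i j k) r"
proof -
  let ?M = "\<Sum>i\<in>Basis. \<Sum>j\<in>Basis. \<Sum>k\<in>Basis. majorant 1 1 (B i j k)"
  define r where "r = 1 / (?M + 1)"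
  have "0 \<le> ?M" by (intro sum_nonneg majorant_nonneg) simp
  then have r: "0 < r" "r * (?M + 1) \<le> 1" by (auto simp: r_def)
  have "majorant r n (gamma_coeff B i j k) \<le> 1" if "i \<in> Basis" "j \<in> Basis" "k \<in> Basis" for i j k n
  proof -
    let ?P = "\<lambda>i j k. majorant r n (gamma_coeff B i j k)"
    have P: "0 \<le> ?P i j k" for i j k using r by (simp add: majorant_nonneg)
    have "?P i j k \<le> (\<Sum>k\<in>Basis. ?P i j k)"
      using that P by (intro member_le_sum) auto
    also have "\<dots> \<le> (\<Sum>j\<in>Basis. \<Sum>k\<in>Basis. ?P i j k)"
      using that P by (intro member_le_sum[of j Basis "\<lambda>j. \<Sum>k\<in>Basis. ?P i j k"]) (auto intro: sum_nonneg)
    also have "\<dots> \<le> (\<Sum>i\<in>Basis. \<Sum>j\<in>Basis. \<Sum>k\<in>Basis. ?P i j k)"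
      using that P by (intro member_le_sum[of i Basis "\<lambda>i. \<Sum>j\<in>Basis. \<Sum>k\<in>Basis. ?P i j k"]) (auto intro!: sum_nonneg)
    also have "\<dots> \<le> 1" using r B by (intro majorant_gamma_coeff_le) auto
    finally show ?thesis .
  qed
  with r show ?thesis by (intro exI[of _ r]) (auto intro: converges_if_majorant_bounded[of _ _ 1])
qed

section \<open>Connections given by Christoffel symbols\<close>

definition contract :: "('a::euclidean_space \<Rightarrow> 'a \<Rightarrow> 'a \<Rightarrow> real) \<Rightarrow> 'a \<Rightarrow> 'a \<Rightarrow> 'a" where
  "contract g y z = (\<Sum>i\<in>Basis. \<Sum>j\<in>Basis. \<Sum>k\<in>Basis. ((y \<bullet> i) * (z \<bullet> j) * g i j k) *\<^sub>R k)"

lemma contract_inner: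
  assumes "k \<in> Basis"
  shows "contract g y z \<bullet> k = (\<Sum>i\<in>Basis. \<Sum>j\<in>Basis. (y \<bullet> i) * (z \<bullet> j) * g i j k)"
  using assms
  by (simp add: contract_def inner_sum_left inner_Basis if_distrib cong: if_cong)

lemma contract_Basis_left:
  assumes "i \<in> Basis" "k \<in> Basis"
  shows "contract g i z \<bullet> k = (\<Sum>j\<in>Basis. (z \<bullet> j) * g i j k)"
proof -
  have "contract g i z \<bullet> k = (\<Sum>i'\<in>Basis. if i' = i then \<Sum>j\<in>Basis. (z \<bullet> j) * g i j k else 0)"
    unfolding contract_inner[OF assms(2)] using assms(1) by (intro sum.cong) (auto simp: inner_Basis)
  then show ?thesis using assms(1) by simp
qed

lemma contract_add_left: "contract g (y + y') z = contract g y z + contract g y' z"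
  by (simp add: contract_def inner_add_left distrib_right scaleR_left_distrib sum.distrib)

lemma contract_add_right: "contract g y (z + z') = contract g y z + contract g y z'"
  by (simp add: contract_def inner_add_left distrib_right distrib_left scaleR_left_distrib sum.distrib)

lemma contract_scaleR_left: "contract g (c *\<^sub>R y) z = c *\<^sub>R contract g y z"
  by (simp add: contract_def scaleR_sum_right mult.assoc)

lemma contract_scaleR_right: "contract g y (c *\<^sub>R z) = c *\<^sub>R contract g y z"
  by (simp add: contract_def scaleR_sum_right mult.left_commute mult.assoc)

lemma contract_zero_left [simp]: "contract g 0 z = 0"
  by (simp add: contract_def)

lemma contract_zero [simp]: "contract (\<lambda>i j k. 0) y z = 0"
  by (simp add: contract_def)

lemma contract_commute:
  assumes "\<And>i j k. i \<in> Basis \<Longrightarrow> j \<in> Basis \<Longrightarrow> k \<in> Basis \<Longrightarrow> g i j k = g j i k"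
  shows "contract g y z = contract g z y"
  unfolding contract_def by (subst sum.swap) (auto intro!: sum.cong simp: assms mult_ac)

lemma contract_has_derivative:
  assumes "\<And>i j k. i \<in> Basis \<Longrightarrow> j \<in> Basis \<Longrightarrow> k \<in> Basis \<Longrightarrow> (g i j k has_derivative g' i j k) (at p)"
  shows "((\<lambda>q. contract (\<lambda>i j k. g i j k q) y z) has_derivative
           (\<lambda>x. contract (\<lambda>i j k. g' i j k x) y z)) (at p)"
  unfolding contract_def
  by (intro has_derivative_sum has_derivative_scaleR_left has_derivative_mult_right assms)

definition chr_connection ::
    "('a::euclidean_space \<Rightarrow> 'a \<Rightarrow> 'a \<Rightarrow> 'a \<Rightarrow> real) \<Rightarrow> ('a \<Rightarrow> 'a) \<Rightarrow> ('a \<Rightarrow> 'a) \<Rightarrow> 'a \<Rightarrow> 'a" where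
  "chr_connection g X Y = (\<lambda>p. dir_deriv X Y p + contract (\<lambda>i j k. g i j k p) (X p) (Y p))"

lemma connection_on_chr_connection:
  fixes g :: "'a::euclidean_space \<Rightarrow> 'a \<Rightarrow> 'a \<Rightarrow> 'a \<Rightarrow> real"
  assumes U: "open U"
    and g: "\<And>i j k. i \<in> Basis \<Longrightarrow> j \<in> Basis \<Longrightarrow> k \<in> Basis \<Longrightarrow> smooth_on (g i j k) U"
  shows "connection_on U (chr_connection g)"
  unfolding connection_on_def vector_field_on_def
proof (intro conjI allI impI ballI)
  fix X Y :: "'a \<Rightarrow> 'a" assume XY: "smooth_on X U" "smooth_on Y U"
  show "smooth_on (chr_connection g X Y) U"
    unfolding chr_connection_def contract_def
    by (intro smooth_on_add smooth_on_dir_deriv smooth_on_sum smooth_on_scaleR smooth_on_mult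
        smooth_on_inner smooth_on_const U XY g)
next
  fix X X' Y :: "'a \<Rightarrow> 'a" and p
  assume "smooth_on Y U" "p \<in> U"
  then have "linear (frechet_derivative Y (at p))"
    by (blast intro: smooth_on_has_derivative has_derivative_linear)
  then show "chr_connection g (\<lambda>q. X q + X' q) Y p = chr_connection g X Y p + chr_connection g X' Y p"
    by (simp add: chr_connection_def dir_deriv_def linear_add contract_add_left)
next
  fix f :: "'a \<Rightarrow> real" and X Y :: "'a \<Rightarrow> 'a" and p
  assume "smooth_on Y U" "p \<in> U"
  then have "linear (frechet_derivative Y (at p))"
    by (blast intro: smooth_on_has_derivative has_derivative_linear)
  then show "chr_connection g (\<lambda>q. f q *\<^sub>R X q) Y p = f p *\<^sub>R chr_connection g X Y p"
    by (simp add: chr_connection_def dir_deriv_def linear_cmul contract_scaleR_left scaleR_right_distrib)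
next
  fix X Y Y' :: "'a \<Rightarrow> 'a" and p
  assume "smooth_on Y U" "smooth_on Y' U" "p \<in> U"
  then have "((\<lambda>q. Y q + Y' q) has_derivative
      (\<lambda>v. frechet_derivative Y (at p) v + frechet_derivative Y' (at p) v)) (at p)"
    by (intro has_derivative_add smooth_on_has_derivative)
  note D = frechet_derivative_at[OF this]
  show "chr_connection g X (\<lambda>q. Y q + Y' q) p = chr_connection g X Y p + chr_connection g X Y' p"
    by (simp add: chr_connection_def dir_deriv_def contract_add_right flip: D)
next
  fix f :: "'a \<Rightarrow> real" and X Y :: "'a \<Rightarrow> 'a" and p
  assume "smooth_on f U" "smooth_on Y U" "p \<in> U"
  then have "((\<lambda>q. f q *\<^sub>R Y q) has_derivative
      (\<lambda>v. f p *\<^sub>R frechet_derivative Y (at p) v + frechet_derivative f (at p) v *\<^sub>R Y p)) (at p)"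
    by (intro has_derivative_scaleR smooth_on_has_derivative)
  note D = frechet_derivative_at[OF this]
  show "chr_connection g X (\<lambda>q. f q *\<^sub>R Y q) p =
      dir_deriv X f p *\<^sub>R Y p + f p *\<^sub>R chr_connection g X Y p"
    by (simp add: chr_connection_def dir_deriv_def contract_scaleR_right scaleR_right_distrib flip: D)
qed

lemma torsion_free_on_chr_connection:
  assumes "\<And>i j k p. i \<in> Basis \<Longrightarrow> j \<in> Basis \<Longrightarrow> k \<in> Basis \<Longrightarrow> g i j k p = g j i k p"
  shows "torsion_free_on U (chr_connection g)"
proof -
  have "contract (\<lambda>i j k. g i j k p) (X p) (Y p) = contract (\<lambda>i j k. g i j k p) (Y p) (X p)" for X Y p
    by (rule contract_commute) (rule assms)
  then show ?thesis
    by (simp add: torsion_free_on_def chr_connection_def lie_bracket_def)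
qed

lemma christoffel_chr_connection:
  assumes "i \<in> Basis" "j \<in> Basis" "k \<in> Basis"
  shows "christoffel (chr_connection g) i j k = g i j k"
proof
  fix p
  have "christoffel (chr_connection g) i j k p = (\<Sum>j'\<in>Basis. (j \<bullet> j') * g i j' k p)"
    using assms
    by (simp add: christoffel_def chr_connection_def dir_deriv_def frechet_derivative_const contract_Basis_left)
  also have "\<dots> = (\<Sum>j'\<in>Basis. if j' = j then g i j k p else 0)"
    using assms by (intro sum.cong) (auto simp: inner_Basis)
  finally show "christoffel (chr_connection g) i j k p = g i j k p"
    using assms by simp
qed

text \<open>Constant fields have zero bracket. The inner covariant derivative of constants is the
  generally nonconstant field \<open>contract g y z\<close>; differentiating it gives the first two
  terms, contracting it again the last two.\<close>

lemma curvature_at_chr_connection: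
  assumes "\<And>i j k. i \<in> Basis \<Longrightarrow> j \<in> Basis \<Longrightarrow> k \<in> Basis \<Longrightarrow> (g i j k has_derivative g' i j k) (at p)"
  shows "curvature_at (chr_connection g) p x y z =
     contract (\<lambda>i j k. g' i j k x) y z - contract (\<lambda>i j k. g' i j k y) x z +
     contract (\<lambda>i j k. g i j k p) x (contract (\<lambda>i j k. g i j k p) y z) -
     contract (\<lambda>i j k. g i j k p) y (contract (\<lambda>i j k. g i j k p) x z)"
proof -
  have const: "chr_connection g (\<lambda>_. y) (\<lambda>_. z) = (\<lambda>q. contract (\<lambda>i j k. g i j k q) y z)" for y z
    by (simp add: chr_connection_def dir_deriv_def frechet_derivative_const)
  have D: "frechet_derivative (\<lambda>q. contract (\<lambda>i j k. g i j k q) y z) (at p) =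
      (\<lambda>x. contract (\<lambda>i j k. g' i j k x) y z)" for y z
    by (rule frechet_derivative_at[symmetric], rule contract_has_derivative, rule assms)
  have "lie_bracket (\<lambda>_. x) (\<lambda>_. y) = (\<lambda>_. 0)"
    by (simp add: lie_bracket_def dir_deriv_def frechet_derivative_const)
  then show ?thesis
    unfolding curvature_at_def curvature_def by (simp add: const) (simp add: chr_connection_def dir_deriv_def D)
qed

lemma sum_rotate:
  "(\<Sum>b\<in>B. \<Sum>i\<in>I. \<Sum>j\<in>J. f b i j) = (\<Sum>i\<in>I. \<Sum>j\<in>J. \<Sum>b\<in>B. f b i j)"
  by (subst sum.swap) (intro sum.cong refl, rule sum.swap)

text \<open>Pure algebra at one point, with \<open>g'\<close> standing for the derivatives as
  independent data. In the trace over \<open>x\<close>, the trace conditions kill the second and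
  third terms of \<open>R\<close>, and the divergence condition makes the other two cancel.\<close>

lemma ricci_flat_operator_if_divergence:
  assumes T: "\<And>x y z. R x y z = contract (g' x) y z - contract (g' y) x z +
       contract g x (contract g y z) - contract g y (contract g x z)"
    and sym: "\<And>i j k. i \<in> Basis \<Longrightarrow> j \<in> Basis \<Longrightarrow> k \<in> Basis \<Longrightarrow> g i j k = g j i k"
    and trace: "\<And>j. j \<in> Basis \<Longrightarrow> (\<Sum>b\<in>Basis. g b j b) = 0"
    and trace': "\<And>j y. j \<in> Basis \<Longrightarrow> (\<Sum>b\<in>Basis. g' y b j b) = 0"
    and divergence: "\<And>i j. i \<in> Basis \<Longrightarrow> j \<in> Basis \<Longrightarrow>
       (\<Sum>b\<in>Basis. g' b i j b) = (\<Sum>a\<in>Basis. \<Sum>b\<in>Basis. g i a b * g j b a)"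
  shows "ricci_flat_operator R"
proof -
  have tr: "(\<Sum>b\<in>Basis. contract h b z \<bullet> b) = 0" if "\<And>j. j \<in> Basis \<Longrightarrow> (\<Sum>b\<in>Basis. h b j b) = 0" for h z
  proof -
    have "(\<Sum>b\<in>Basis. contract h b z \<bullet> b) = (\<Sum>b\<in>Basis. \<Sum>j\<in>Basis. (z \<bullet> j) * h b j b)"
      by (intro sum.cong refl) (simp add: contract_Basis_left)
    also have "\<dots> = (\<Sum>j\<in>Basis. (z \<bullet> j) * (\<Sum>b\<in>Basis. h b j b))"
      by (subst sum.swap) (simp add: sum_distrib_left)
    finally show ?thesis using that by simp
  qed
  have "ricci_tensor R y z = 0" for y z
  proof -
    have 1: "(\<Sum>b\<in>Basis. contract (g' b) y z \<bullet> b) =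
        (\<Sum>i\<in>Basis. \<Sum>j\<in>Basis. (y \<bullet> i) * (z \<bullet> j) * (\<Sum>a\<in>Basis. \<Sum>b\<in>Basis. g i a b * g j b a))"
    proof -
      have "(\<Sum>b\<in>Basis. contract (g' b) y z \<bullet> b) =
          (\<Sum>b\<in>Basis. \<Sum>i\<in>Basis. \<Sum>j\<in>Basis. (y \<bullet> i) * (z \<bullet> j) * g' b i j b)"
        by (simp add: contract_inner)
      also have "\<dots> = (\<Sum>i\<in>Basis. \<Sum>j\<in>Basis. \<Sum>b\<in>Basis. (y \<bullet> i) * (z \<bullet> j) * g' b i j b)"
        by (rule sum_rotate)
      finally show ?thesis by (simp add: divergence flip: sum_distrib_left)
    qed
    have "(\<Sum>b\<in>Basis. contract g y (contract g b z) \<bullet> b) =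
        (\<Sum>b\<in>Basis. \<Sum>i\<in>Basis. \<Sum>a\<in>Basis. (y \<bullet> i) * (\<Sum>j\<in>Basis. (z \<bullet> j) * g b j a) * g i a b)"
      by (intro sum.cong refl) (simp add: contract_inner[of _ g y] contract_Basis_left)
    \<comment> \<open>Symmetry in the lower indices turns \<open>g b j a\<close> into
      \<open>g j b a\<close>, the form occurring in the divergence condition.\<close>
    also have "\<dots> = (\<Sum>b\<in>Basis. \<Sum>i\<in>Basis. \<Sum>a\<in>Basis. \<Sum>j\<in>Basis. (y \<bullet> i) * (z \<bullet> j) * (g i a b * g j b a))"
      by (intro sum.cong refl) (simp add: sum_distrib_left sum_distrib_right sym mult_ac)
    also have "\<dots> = (\<Sum>i\<in>Basis. \<Sum>j\<in>Basis. (y \<bullet> i) * (z \<bullet> j) * (\<Sum>a\<in>Basis. \<Sum>b\<in>Basis. g i a b * g j b a))"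
      unfolding sum_distrib_left
      by (subst sum.swap, rule sum.cong[OF refl], subst sum.swap, rule sum_rotate[symmetric])
    finally have 2: "(\<Sum>b\<in>Basis. contract g y (contract g b z) \<bullet> b) = \<dots>" .
    show ?thesis
      using tr[of "g' y" z] tr[of g "contract g y z"] trace trace' 1 2
      by (simp add: ricci_tensor_def endo_trace_def T inner_diff_left inner_add_left sum_subtractf sum.distrib)
  qed
  then show ?thesis by (simp add: ricci_flat_operator_def)
qed

section \<open>The Ricci flat connection\<close>

text \<open>The power series of the linear form sending \<open>x\<close> to
  \<open>L x i j \<bullet> k\<close>: the first argument of \<open>L\<close> is the base point, the
  other two are the lower indices.\<close>

definition linear_coeff :: "('a::euclidean_space \<Rightarrow> 'a \<Rightarrow> 'a \<Rightarrow> 'a) \<Rightarrow> 'a \<Rightarrow> 'a \<Rightarrow> 'a \<Rightarrow> ('a \<Rightarrow> nat) \<Rightarrow> real" where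
  "linear_coeff L i j k \<alpha> = (\<Sum>l\<in>Basis. if \<alpha> = unit_index l then L l i j \<bullet> k else 0)"

lemma linear_coeff_unit_index: "l \<in> Basis \<Longrightarrow> linear_coeff L i j k (unit_index l) = L l i j \<bullet> k"
  by (simp add: linear_coeff_def)

lemma linear_coeff_eq_0: "deg \<alpha> \<noteq> 1 \<Longrightarrow> linear_coeff L i j k \<alpha> = 0"
  by (auto simp: linear_coeff_def intro!: sum.neutral)

lemma pderiv_linear_coeff:
  assumes "k \<in> Basis" "\<alpha> \<in> multi_indices"
  shows "pderiv_coeff k (linear_coeff L i j k') \<alpha> = (if \<alpha> = 0 then L k i j \<bullet> k' else 0)"
proof (cases "\<alpha> = 0")
  case True
  then show ?thesis using assms linear_coeff_unit_index by (simp add: pderiv_coeff_def)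
next
  case False
  then have "deg (\<alpha> + unit_index k) \<noteq> 1" using assms by (simp add: deg_eq_0_iff)
  with False show ?thesis by (simp add: pderiv_coeff_def linear_coeff_eq_0)
qed

lemma contract_linear:
  fixes L :: "'a::euclidean_space \<Rightarrow> 'a \<Rightarrow> 'a \<Rightarrow> 'a"
  assumes "\<And>y z. linear (\<lambda>x. L x y z)" "\<And>x z. linear (\<lambda>y. L x y z)" "\<And>x y. linear (\<lambda>z. L x y z)"
  shows "contract (\<lambda>i j k. \<Sum>l\<in>Basis. (x \<bullet> l) * (L l i j \<bullet> k)) y z = L x y z"
proof (rule euclidean_eqI)
  fix k :: 'a assume k: "k \<in> Basis"
  have "L x y z = (\<Sum>i\<in>Basis. (y \<bullet> i) *\<^sub>R L x i z)"
    using linear_euclidean_expansion[OF assms(2)] .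
  also have "\<dots> = (\<Sum>i\<in>Basis. (y \<bullet> i) *\<^sub>R (\<Sum>j\<in>Basis. (z \<bullet> j) *\<^sub>R L x i j))"
    by (subst linear_euclidean_expansion[OF assms(3)]) simp
  also have "\<dots> = (\<Sum>i\<in>Basis. (y \<bullet> i) *\<^sub>R (\<Sum>j\<in>Basis. (z \<bullet> j) *\<^sub>R (\<Sum>l\<in>Basis. (x \<bullet> l) *\<^sub>R L l i j)))"
    by (subst linear_euclidean_expansion[OF assms(1)]) simp
  finally show "contract (\<lambda>i j k. \<Sum>l\<in>Basis. (x \<bullet> l) * (L l i j \<bullet> k)) y z \<bullet> k = L x y z \<bullet> k"
    by (simp add: contract_inner[OF k] inner_sum_left sum_distrib_left mult.assoc)
qed

context
  fixes L :: "'a::euclidean_space \<Rightarrow> 'a \<Rightarrow> 'a \<Rightarrow> 'a"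
  assumes dim: "DIM('a) \<ge> 3"
    and lin: "\<And>y z. linear (\<lambda>x. L x y z)" "\<And>x z. linear (\<lambda>y. L x y z)" "\<And>x y. linear (\<lambda>z. L x y z)"
    and L_sym: "\<And>x y z. L x y z = L x z y"
    and L_trace: "\<And>x z. (\<Sum>b\<in>Basis. L x b z \<bullet> b) = 0"
    and L_div: "\<And>y z. (\<Sum>b\<in>Basis. L b y z \<bullet> b) = 0"
begin

abbreviation (input) "\<Gamma> \<equiv> gamma_coeff (linear_coeff L)"

text \<open>Since \<open>third b j\<close> differs from \<open>b\<close>, the recursion never
  corrects a component entering the trace, and \<open>L_trace\<close> settles the linear
  part.\<close>

lemma Gamma_trace:
  assumes "j \<in> Basis"
  shows "(\<Sum>b\<in>Basis. \<Gamma> b j b \<alpha>) = 0"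
proof -
  have "\<Gamma> b j b \<alpha> = linear_coeff L b j b \<alpha>" for b
    using third_in[OF dim, of b j] by (auto simp: gamma_coeff_eq[of _ b j b])
  then have "(\<Sum>b\<in>Basis. \<Gamma> b j b \<alpha>) = (\<Sum>b\<in>Basis. \<Sum>l\<in>Basis. if \<alpha> = unit_index l then L l b j \<bullet> b else 0)"
    by (simp add: linear_coeff_def[of L _ _ _ \<alpha>])
  also have "\<dots> = (\<Sum>l\<in>Basis. \<Sum>b\<in>Basis. if \<alpha> = unit_index l then L l b j \<bullet> b else 0)"
    by (rule sum.swap)
  also have "\<dots> = (\<Sum>l\<in>Basis. if \<alpha> = unit_index l then \<Sum>b\<in>Basis. L l b j \<bullet> b else 0)"
    by (intro sum.cong) auto
  finally show ?thesis by (simp add: L_trace cong: if_cong)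
qed

text \<open>The linear part drops out by \<open>L_div\<close>; of all \<open>k\<close>, exactly
  \<open>third i j\<close> carries the quadratic term.\<close>

lemma Gamma_divergence:
  assumes "\<alpha> \<in> multi_indices"
  shows "(\<Sum>k\<in>Basis. pderiv_coeff k (\<Gamma> i j k) \<alpha>) =
    (\<Sum>a\<in>Basis. \<Sum>b\<in>Basis. index_convolution (\<Gamma> i a b) (\<Gamma> j b a) \<alpha>)"
proof -
  have "(\<Sum>k\<in>Basis. pderiv_coeff k (linear_coeff L i j k) \<alpha>) = (\<Sum>k\<in>Basis. if \<alpha> = 0 then L k i j \<bullet> k else 0)"
    by (intro sum.cong refl pderiv_linear_coeff assms)
  also have "\<dots> = 0" by (cases "\<alpha> = 0") (simp_all add: L_div)
  finally show ?thesis
    using third_in[OF dim, of i j] by (simp add: pderiv_gamma_coeff sum.distrib)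
qed

lemma Gamma_at_0: "\<Gamma> i j k 0 = 0"
  by (simp add: gamma_coeff_eq[of _ i j k] linear_coeff_eq_0)

text \<open>In degree one the correction evaluates the convolution at index 0, where both factors
  vanish. Hence the 1-jet at the origin is that of \<open>L\<close>.\<close>

lemma Gamma_unit_index:
  assumes "l \<in> Basis"
  shows "\<Gamma> i j k (unit_index l) = L l i j \<bullet> k"
proof -
  have "index_convolution (\<Gamma> i a b) (\<Gamma> j b a) (unit_index l - unit_index k) = 0" if "0 < unit_index l k" for a b
  proof -
    have "k = l" using that by (simp add: unit_index_def split: if_splits)
    then have "unit_index l - unit_index k = 0" by (simp add: fun_eq_iff)
    moreover have "{..0 :: 'a \<Rightarrow> nat} = {0}" by (auto simp: le_fun_def fun_eq_iff)
    ultimately show ?thesis by (simp add: index_convolution_def Gamma_at_0)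
  qed
  then show ?thesis
    unfolding gamma_coeff_eq[of _ i j k "unit_index l"] linear_coeff_unit_index[OF assms]
    by (auto intro!: sum.neutral)
qed

lemma ricci_flat_connection_exists:
  "\<exists>U D. open U \<and> 0 \<in> U \<and> real_analytic_connection_on U D \<and> torsion_free_on U D \<and> ricci_flat_on U D \<and>
     (\<forall>x y z. curvature_at D 0 x y z = L x y z - L y x z)"
proof -
  have "\<exists>r>0. \<forall>i\<in>Basis. \<forall>j\<in>Basis. \<forall>k\<in>Basis. converges (\<Gamma> i j k) r"
    by (rule gamma_coeff_converges) (rule linear_coeff_eq_0)
  then obtain r where r: "r > 0"
      and conv: "\<And>i j k. i \<in> Basis \<Longrightarrow> j \<in> Basis \<Longrightarrow> k \<in> Basis \<Longrightarrow> converges (\<Gamma> i j k) r"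
    by blast
  define g where "g i j k = power_series (\<Gamma> i j k)" for i j k
  \<comment> \<open>Base point and direction come first, so that \<open>g' p\<close> has the shape
    expected by \<open>ricci_flat_operator_if_divergence\<close>.\<close>
  define g' where "g' p v i j k = (\<Sum>l\<in>Basis. (v \<bullet> l) * power_series (pderiv_coeff l (\<Gamma> i j k)) p)" for p v i j k
  define U where "U = (polydisc r :: 'a set)"
  let ?D = "chr_connection g"
  have U: "open U" "0 \<in> U" using r by (simp_all add: U_def open_polydisc) (simp add: polydisc_def)
  have g_sym: "g i j k p = g j i k p" for i j k p
  proof -
    have "linear_coeff L i j k \<alpha> = linear_coeff L j i k \<alpha>" for \<alpha>
      by (simp add: linear_coeff_def L_sym[of _ i j] cong: if_cong)
    then show ?thesis by (simp add: g_def gamma_coeff_commute[of "linear_coeff L" i j k])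
  qed
  have deriv: "(g i j k has_derivative (\<lambda>v. g' p v i j k)) (at p)"
    if "i \<in> Basis" "j \<in> Basis" "k \<in> Basis" "p \<in> U" for i j k p
    unfolding g_def g'_def using that by (intro power_series_has_derivative[of _ r] conv) (auto simp: U_def)
  have "connection_on U ?D"
    using conv by (intro connection_on_chr_connection U) (simp add: g_def U_def smooth_on_power_series)
  then have "real_analytic_connection_on U ?D"
    using conv by (auto simp: real_analytic_connection_on_def christoffel_chr_connection g_def U_def
        intro: real_analytic_on_power_series)
  moreover have "torsion_free_on U ?D"
    by (rule torsion_free_on_chr_connection) (rule g_sym)
  moreover have curv: "curvature_at ?D p x y z =
      contract (g' p x) y z - contract (g' p y) x z +
      contract (\<lambda>i j k. g i j k p) x (contract (\<lambda>i j k. g i j k p) y z) -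
      contract (\<lambda>i j k. g i j k p) y (contract (\<lambda>i j k. g i j k p) x z)" if "p \<in> U" for p x y z
    by (rule curvature_at_chr_connection[of g "\<lambda>i j k v. g' p v i j k"]) (rule deriv[OF _ _ _ that])
  have "ricci_flat_operator (curvature_at ?D p)" if p: "p \<in> U" for p
  proof (rule ricci_flat_operator_if_divergence[where g' = "g' p" and g = "\<lambda>i j k. g i j k p"])
    fix j y :: 'a assume j: "j \<in> Basis"
    show "(\<Sum>b\<in>Basis. g b j b p) = 0"
      unfolding g_def using p conv j Gamma_trace by (intro power_series_sum_eq_0[of _ r]) (auto simp: U_def)
    \<comment> \<open>Differentiation acts linearly on coefficients, so the vanishing of the trace
      passes to every partial derivative.\<close>
    have "(\<Sum>b\<in>Basis. power_series (pderiv_coeff l (\<Gamma> b j b)) p) = 0" if "l \<in> Basis" for l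
      using p conv j Gamma_trace that
      by (intro power_series_sum_eq_0[of _ r] converges_pderiv_coeff)
         (auto simp: U_def pderiv_coeff_def simp flip: sum_distrib_left)
    moreover have "(\<Sum>b\<in>Basis. g' p y b j b) =
        (\<Sum>l\<in>Basis. (y \<bullet> l) * (\<Sum>b\<in>Basis. power_series (pderiv_coeff l (\<Gamma> b j b)) p))"
      unfolding g'_def sum_distrib_left by (rule sum.swap)
    ultimately show "(\<Sum>b\<in>Basis. g' p y b j b) = 0" by simp
  next
    fix i j :: 'a assume ij: "i \<in> Basis" "j \<in> Basis"
    let ?C = "\<lambda>\<alpha>. \<Sum>a\<in>Basis. \<Sum>b\<in>Basis. index_convolution (\<Gamma> i a b) (\<Gamma> j b a) \<alpha>"
    have quadratic: "((\<lambda>\<alpha>. ?C \<alpha> * mon p \<alpha>) has_sum (\<Sum>a\<in>Basis. \<Sum>b\<in>Basis. g i a b p * g j b a p)) multi_indices"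
      unfolding g_def using p ij
      by (intro power_series_sum power_series_mult[of _ r] conv) (auto simp: U_def)
    have "((\<lambda>\<alpha>. (\<Sum>k\<in>Basis. pderiv_coeff k (\<Gamma> i j k) \<alpha>) * mon p \<alpha>) has_sum
        (\<Sum>k\<in>Basis. power_series (pderiv_coeff k (\<Gamma> i j k)) p)) multi_indices"
      using p ij
      by (intro power_series_sum power_series_has_sum[of _ r] converges_pderiv_coeff conv) (auto simp: U_def)
    \<comment> \<open>By the coefficient identity one and the same family sums to the divergence and
      to the quadratic term; uniqueness of \<open>has_sum\<close> then equates them.\<close>
    then have divergence: "((\<lambda>\<alpha>. ?C \<alpha> * mon p \<alpha>) has_sum
        (\<Sum>k\<in>Basis. power_series (pderiv_coeff k (\<Gamma> i j k)) p)) multi_indices"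
      by (rule has_sum_cong[THEN iffD1, rotated]) (simp add: Gamma_divergence)
    have "g' p k i j k = power_series (pderiv_coeff k (\<Gamma> i j k)) p" if "k \<in> Basis" for k
    proof -
      have "g' p k i j k = (\<Sum>l\<in>Basis. if l = k then power_series (pderiv_coeff k (\<Gamma> i j k)) p else 0)"
        unfolding g'_def using that by (intro sum.cong) (auto simp: inner_Basis)
      then show ?thesis using that by simp
    qed
    then show "(\<Sum>b\<in>Basis. g' p b i j b) = (\<Sum>a\<in>Basis. \<Sum>b\<in>Basis. g i a b p * g j b a p)"
      using has_sum_unique[OF divergence quadratic] by simp
  qed (simp_all add: curv[OF p] g_sym)
  then have "ricci_flat_on U ?D" by (simp add: ricci_flat_on_def)
  moreover have "curvature_at ?D 0 x y z = L x y z - L y x z" for x y z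
  proof -
    \<comment> \<open>At the origin a power series is its constant coefficient, so the derivatives
      there read off the degree-one coefficients.\<close>
    have "g' 0 v = (\<lambda>i j k. \<Sum>l\<in>Basis. (v \<bullet> l) * (L l i j \<bullet> k))" for v
      by (intro ext) (simp add: g'_def power_series_at_0 pderiv_coeff_def Gamma_unit_index)
    then have "contract (g' 0 v) y z = L v y z" for v y z
      using contract_linear[OF lin] by simp
    moreover have "g i j k 0 = 0" for i j k
      by (simp add: g_def power_series_at_0 Gamma_at_0)
    ultimately show ?thesis using U by (simp add: curv)
  qed
  ultimately show ?thesis using U by blast
qed

end

theorem theorem5:
  fixes A :: "'a::euclidean_space \<Rightarrow> 'a \<Rightarrow> 'a \<Rightarrow> 'a"
  assumes "DIM('a) \<ge> 3"
    and "A \<in> equiaffine_curvature_operators"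
    and "ricci_flat_operator A"
  shows "\<exists>U D. open U \<and> 0 \<in> U \<and>
           real_analytic_connection_on U D \<and> torsion_free_on U D \<and> ricci_flat_on U D \<and>
           curvature_at D 0 = A"
proof -
  from assms(2) have lin: "linear (\<lambda>x. A x y z)" "linear (\<lambda>y. A x y z)" "linear (\<lambda>z. A x y z)"
    and skew: "A x y z = - A y x z" and bianchi: "A x y z + A y z x + A z x y = 0" for x y z
    unfolding equiaffine_curvature_operators_def algebraic_curvature_operator_def by blast+
  from assms(3) have ricci: "(\<Sum>b\<in>Basis. A b x y \<bullet> b) = 0" for x y
    by (simp add: ricci_flat_operator_def ricci_tensor_def endo_trace_def)
  \<comment> \<open>Skew symmetrising \<open>A x y z + A x z y\<close> in \<open>x, y\<close> gives
    \<open>3 *\<^sub>R A x y z\<close> by the Bianchi identity; this fixes the factor.\<close>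
  define L where "L x y z = (1 / 3) *\<^sub>R (A x y z + A x z y)" for x y z
  have "\<exists>U D. open U \<and> 0 \<in> U \<and> real_analytic_connection_on U D \<and> torsion_free_on U D \<and> ricci_flat_on U D \<and>
     (\<forall>x y z. curvature_at D 0 x y z = L x y z - L y x z)"
  proof (rule ricci_flat_connection_exists[OF assms(1)])
    show "linear (\<lambda>x. L x y z)" "linear (\<lambda>y. L x y z)" "linear (\<lambda>z. L x y z)" for x y z
      unfolding L_def by (intro linear_compose_scale_right linear_compose_add lin)+
    show "L x y z = L x z y" for x y z by (simp add: L_def add.commute)
    show "(\<Sum>b\<in>Basis. L b y z \<bullet> b) = 0" for y z
      using ricci by (simp add: L_def inner_add_left sum.distrib flip: sum_divide_distrib)
    show "(\<Sum>b\<in>Basis. L x b z \<bullet> b) = 0" for x z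
    proof -
      \<comment> \<open>The Bianchi identity moves \<open>b\<close> into the first slot of each
        term, where summation over \<open>b\<close> produces Ricci contractions of
        \<open>A\<close>.\<close>
      have "A x b z + A x z b = A b z x - 2 *\<^sub>R A b x z" for b
        using bianchi[of x z b] skew[of x b z] skew[of z b x]
        by (simp add: algebra_simps scaleR_2)
      then show ?thesis
        using ricci by (simp add: L_def inner_diff_left sum_subtractf flip: sum_divide_distrib sum_distrib_left)
    qed
  qed
  moreover have "L x y z - L y x z = A x y z" for x y z
  proof -
    have "A x z y - A y z x = A x y z"
      using bianchi[of x y z] skew[of z x y] by (simp add: algebra_simps)
    then have "(A x y z + A x z y) - (A y x z + A y z x) = 3 *\<^sub>R A x y z"
      using skew[of y x z] scaleR_left_distrib[of 2 1 "A x y z"] by (simp add: algebra_simps scaleR_2)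
    then show ?thesis by (simp add: L_def flip: scaleR_diff_right)
  qed
  ultimately show ?thesis by (simp add: fun_eq_iff)
qed

end
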